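(* Let $c_1,c_2>0$, $p>1$, $T>0$, let $g:\mathbb R\to(0,\infty)$ be a Borel function, and put $I=g(W_T)$. Let $$\tau=\inf\left\{t>0:\ W_t\ge \frac{1}{c_2(p-1)I^{p-1}}-\frac{c_1}{c_2}t\right\}.$$ For $x\in\mathbb R$ and $r>0$ define $$a(x)=\frac{1}{c_2(p-1)(g(x))^{p-1}}-x-\frac{c_1T}{c_2},\qquad v=\frac1r-\frac1T .$$ Let $\Phi$ be the standard normal distribution function and let $\phi_T(x)=\frac{1}{\sqrt{2\pi T}}e^{-x^2/(2T)}$ be the normal density with mean $0$ and variance $T$. Then: (i) If $r<T$, $$P(\tau\le r)=1-\int_{-\infty}^{\infty}\Phi\left(\frac{a(x)}{T\sqrt v}+\frac{\sqrt v}{c_2(p-1)(g(x))^{p-1}}\right)\phi_T(x)\,dx$$ $$\quad+\int_{-\infty}^{\infty}\exp\left(\frac{-2a(x)}{Tc_2(p-1)(g(x))^{p-1}}\right)\Phi\left(\frac{a(x)}{T\sqrt v}-\frac{\sqrt v}{c_2(p-1)(g(x))^{p-1}}\right)\phi_T(x)\,dx.$$ (ii) If $r=T$, $$P(\tau\le r)=1-\int_{-\infty}^{\infty}\mathbf 1_{\{a(x)>0\}}\phi_T(x)\,dx+\int_{-\infty}^{\infty}\exp\left(\frac{-2a(x)}{Tc_2(p-1)(g(x))^{p-1}}\right)\mathbf 1_{\{a(x)>0\}}\phi_T(x)\,dx.$$ (iii) If $r>T$, $$P(\tau\le r)=\int_{-\infty}^{\infty}\exp\left(\frac{-2a(x)}{Tc_2(p-1)(g(x))^{p-1}}\right)\Phi\left(\frac{a(x)}{\sqrt{r-T}}-\frac{c_1\sqrt{r-T}}{c_2}\right)\mathbf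 1_{\{a(x)>0\}}\phi_T(x)\,dx$$ $$\quad-\int_{-\infty}^{\infty}\exp\left(\frac{-2a(x)}{Tc_2(p-1)(g(x))^{p-1}}+\frac{2a(x)c_1}{c_2}\right)\Phi\left(\frac{-a(x)}{\sqrt{r-T}}-\frac{c_1\sqrt{r-T}}{c_2}\right)\mathbf 1_{\{a(x)>0\}}\phi_T(x)\,dx$$ $$\quad+1-\int_{-\infty}^{\infty}\Phi\left(\frac{a(x)}{\sqrt{r-T}}-\frac{c_1\sqrt{r-T}}{c_2}\right)\mathbf 1_{\{a(x)>0\}}\phi_T(x)\,dx$$ $$\quad+\int_{-\infty}^{\infty}\exp\left(\frac{2a(x)c_1}{c_2}\right)\Phi\left(\frac{-a(x)}{\sqrt{r-T}}-\frac{c_1\sqrt{r-T}}{c_2}\right)\mathbf 1_{\{a(x)>0\}}\phi_T(x)\,dx.$$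
   Context: $W=(W_t)_{t\ge0}$ is a standard Brownian motion (with $W_0=0$) on a probability space $(\Omega,\mathcal F,P)$. By convention $\inf\emptyset=\infty$, and $\mathbf 1_{\{\cdot\}}$ is the indicator function. The random time $\tau$ is the blow up (explosion) time of the process $L^I_t=\left(I^{1-p}-c_1(p-1)t-c_2(p-1)W_t\right)^{1/(1-p)}$, which is the local solution of the anticipating stochastic differential equation $L^{I}_t=I+\int_0^t\left(c_1(L^{I}_s)^p+\frac{pc_2^2}{2}(L_s^{I})^{2p-1}\right)ds+\int_0^tc_2(L_s^{I})^p\,d^-W_s$ (forward integral) with initial condition $I=g(W_T)$. *)

theory Defs
  imports "HOL-Probability.Probability"
begin

text \<open>
  Standard Brownian motion on \<open>M\<close>.  The process is indexed by all of \<^typ>\<open>real\<close>, but only the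
  values at times \<open>t \<ge> 0\<close> are constrained.  The initial value and path continuity are required
  surely (not just almost surely) on \<^term>\<open>space M\<close>, so that hitting events are measurable
  without assuming \<open>M\<close> complete.
\<close>

locale standard_brownian_motion = prob_space M for M :: "'a measure" +
  fixes W :: "real \<Rightarrow> 'a \<Rightarrow> real"
  assumes W_random_variable: "\<And>t. 0 \<le> t \<Longrightarrow> random_variable borel (W t)"
    and W_zero: "\<And>\<omega>. \<omega> \<in> space M \<Longrightarrow> W 0 \<omega> = 0"
    and W_continuous: "\<And>\<omega>. \<omega> \<in> space M \<Longrightarrow> continuous_on {0..} (\<lambda>t. W t \<omega>)"
    and W_increment: "\<And>s t. 0 \<le> s \<Longrightarrow> s < t \<Longrightarrow>
      distributed M lborel (\<lambda>\<omega>. W t \<omega> - W s \<omega>) (normal_density 0 (sqrt (t - s)))"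
    and W_indep_increments: "\<And>(n::nat) t. 0 \<le> t 0 \<Longrightarrow> (\<And>i. i < n \<Longrightarrow> t i \<le> t (Suc i)) \<Longrightarrow>
      indep_vars (\<lambda>_. borel) (\<lambda>i \<omega>. W (t (Suc i)) \<omega> - W (t i) \<omega>) {..<n}"

abbreviation std_normal_cdf :: "real \<Rightarrow> real"  ("\<Phi>")
  where "\<Phi> \<equiv> cdf std_normal_distribution"

end

theory Submission
  imports Defs
begin

text \<open>
  Write \<open>\<mu> = c\<^sub>1 / c\<^sub>2\<close> and \<open>\<beta> x = 1 / (c\<^sub>2 (p - 1) (g x)\<^bsup>p-1\<^esup>)\<close>.  Blow-up by time \<open>r\<close> means that the
  Brownian motion with drift \<open>W t + \<mu> t\<close> reaches the level \<open>\<beta> (W T)\<close> during \<open>[0, r]\<close>.  The level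
  anticipates the endpoint \<open>W T\<close>, but once \<open>W T = x\<close> is given it is the constant \<open>\<beta> x\<close>.  So the
  formula follows from the probability \<open>K b x\<close> that the drifted path stays below a constant level
  \<open>b\<close> up to time \<open>r\<close> given \<open>W T = x\<close>, and the result is \<open>1 - \<integral> K (\<beta> x) x \<phi>\<^sub>T x dx\<close>.

  Conditioning on the null event \<open>W T = x\<close> is replaced by a statement about measures: for a
  constant \<open>b\<close> and Borel \<open>A\<close>, the probability of staying below \<open>b\<close> with \<open>W T \<in> A\<close> is the integral of
  \<open>K b x \<phi>\<^sub>T x\<close> over \<open>A\<close>.  If \<open>\<beta>\<close> has finitely many values, summing over the values gives the claim,
  and a general \<open>\<beta>\<close> is the increasing limit of such functions
  (\<open>expectation_unhit_random_barrier\<close>).  This works because \<open>K b x\<close> is continuous in \<open>b\<close> and because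
  staying strictly below is continuous under increasing limits of the level.

  The kernel \<open>K\<close> comes from the joint law of staying below \<open>b\<close> up to \<open>r\<close> and of \<open>W r\<close>
  (\<open>expectation_unhit_terminal\<close>).  Let \<open>D t = b - \<mu> t - W t\<close> be the gap.  A path that has hit starts
  afresh from gap \<open>0\<close>, and from there the density of the gap at \<open>-d\<close> is \<open>exp (2 \<mu> d)\<close> times the density
  at \<open>d\<close>.  Hence a function \<open>G\<close> with \<open>G (-d) = - exp (- 2 \<mu> d) G d\<close> for \<open>d > 0\<close> has mean zero over the
  paths that hit (\<open>hitting_reflection\<close>).  Since a negative gap at time \<open>r\<close> forces a hit, this
  expresses the law of the gap on paths that hit and come back by the normal law of \<open>D r\<close>: given
  \<open>D r = d > 0\<close>, the probability of having hit is \<open>exp (- 2 b d / r)\<close>.  The restart at the hitting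
  time is reduced to the Markov property at deterministic times: the hitting time is rounded up to
  a grid, and the error vanishes with the mesh because \<open>G\<close> is Lipschitz.

  The three cases of the theorem are the positions of \<open>r\<close> relative to \<open>T\<close>.  For \<open>r = T\<close> the joint law
  is the answer.  For \<open>r > T\<close> it is applied up to \<open>T\<close>, and then the motion restarted at \<open>T\<close> has to
  survive for \<open>r - T\<close> from the gap \<open>D T\<close>.  For \<open>r < T\<close> the increment from \<open>r\<close> to \<open>T\<close> is integrated out,
  and given \<open>W T = x\<close> the value \<open>W r\<close> is normal with the Brownian bridge mean and variance.
\<close>

section \<open>Integrals of the normal density\<close>

lemma std_normal_cdf_nonneg: "0 \<le> \<Phi> x"
  by (simp add: cdf_def2)

lemma std_normal_cdf_le_1: "\<Phi> x \<le> 1"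
  by (rule real_distribution.cdf_bounded_prob[OF real_dist_normal_dist])

lemma measure_std_normal_singleton: "measure std_normal_distribution {x} = 0"
proof -
  have "emeasure std_normal_distribution {x} =
      (\<integral>\<^sup>+y. ennreal (std_normal_density y) * indicator {x} y \<partial>lborel)"
    by (rule emeasure_density) auto
  also have "\<dots> = 0"
    by (rule nn_integral_null_set) (simp add: null_sets_def)
  finally show ?thesis by (simp add: measure_def)
qed

lemma isCont_std_normal_cdf: "isCont \<Phi> x"
  using finite_borel_measure.isCont_cdf[OF real_distribution.finite_borel_measure_M[OF real_dist_normal_dist]]
  by (simp add: measure_std_normal_singleton)

lemma continuous_std_normal_cdf [continuous_intros]:
  assumes "continuous_on S f"
  shows "continuous_on S (\<lambda>x. \<Phi> (f x))"
proof (rule continuous_on_compose2[OF _ assms])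
  show "continuous_on UNIV \<Phi>"
    by (rule continuous_at_imp_continuous_on) (simp add: isCont_std_normal_cdf)
qed simp

lemma borel_measurable_std_normal_cdf [measurable]: "\<Phi> \<in> borel_measurable borel"
  by (rule borel_measurable_continuous_onI, rule continuous_at_imp_continuous_on)
    (simp add: isCont_std_normal_cdf)

lemma integral_normal_density_below:
  assumes \<sigma>: "0 < \<sigma>"
  shows "(LINT z|lborel. of_bool (z < c) * normal_density m \<sigma> z) = \<Phi> ((c - m) / \<sigma>)"
proof -
  interpret prob_space std_normal_distribution
    by (rule prob_space_normal_density) simp
  define x where "x = (c - m) / \<sigma>"
  have "(LINT z|lborel. of_bool (z < c) * normal_density m \<sigma> z) =
      \<sigma> * (LINT y|lborel. of_bool (m + \<sigma> * y < c) * normal_density m \<sigma> (m + \<sigma> * y))"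
    using lborel_integral_real_affine[of \<sigma> "\<lambda>z. of_bool (z < c) * normal_density m \<sigma> z" m] \<sigma>
    by (simp only: abs_of_pos real_scaleR_def)
  also have "\<dots> = (LINT y|lborel. \<sigma> * (of_bool (m + \<sigma> * y < c) * normal_density m \<sigma> (m + \<sigma> * y)))"
    by simp
  also have "\<dots> = (LINT y|lborel. std_normal_density y * indicator {..<x} y)"
  proof (intro Bochner_Integration.integral_cong refl)
    fix y
    have "m + \<sigma> * y < c \<longleftrightarrow> y < x"
      using \<sigma> by (simp add: x_def field_simps)
    moreover have "\<sigma> * normal_density m \<sigma> (m + \<sigma> * y) = std_normal_density y"
    proof -
      have "sqrt (2 * pi * \<sigma>\<^sup>2) = sqrt (2 * pi) * \<sigma>"
        using \<sigma> by (simp add: real_sqrt_mult)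
      moreover have "- (m + \<sigma> * y - m)\<^sup>2 / (2 * \<sigma>\<^sup>2) = - y\<^sup>2 / 2"
        using \<sigma> by (simp add: power_mult_distrib)
      ultimately show ?thesis
        using \<sigma> by (simp only: normal_density_def) simp
    qed
    ultimately show "\<sigma> * (of_bool (m + \<sigma> * y < c) * normal_density m \<sigma> (m + \<sigma> * y)) =
        std_normal_density y * indicator {..<x} y"
      by (simp add: indicator_def)
  qed
  also have "\<dots> = (LINT y|std_normal_distribution. indicator {..<x} y)"
    by (subst integral_density) auto
  also have "\<dots> = measure std_normal_distribution {..<x}"
    by simp
  also have "\<dots> = measure std_normal_distribution {..<x} + measure std_normal_distribution {x}"
    by (simp add: measure_std_normal_singleton)
  also have "\<dots> = measure std_normal_distribution ({..<x} \<union> {x})"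
    by (intro finite_measure_Union[symmetric]) auto
  also have "{..<x} \<union> {x} = {..x}" by auto
  finally show ?thesis by (simp add: cdf_def2 x_def)
qed

text \<open>
  The square is completed in the form needed when a Gaussian exponent with mean linear in its
  variance \<open>k\<close> is expanded.
\<close>
lemma complete_square:
  fixes k a y :: real
  assumes "k \<noteq> 0"
  shows "(a * k + y)\<^sup>2 / (2 * k) = a\<^sup>2 * k / 2 + a * y + y\<^sup>2 / (2 * k)"
proof -
  have "(a * k + y)\<^sup>2 / (2 * k) = (a\<^sup>2 * k * k + 2 * a * y * k + y\<^sup>2) / (2 * k)"
    by (simp add: power2_eq_square algebra_simps)
  also have "\<dots> = a\<^sup>2 * k / 2 + a * y + y\<^sup>2 / (2 * k)"
    using assms by (simp add: add_divide_distrib)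
  finally show ?thesis .
qed

text \<open>
  Multiplying a normal density by an exponential shifts its mean and leaves its variance; this
  produces the second \<open>\<Phi>\<close> term of each formula.
\<close>
lemma exp_tilt_normal_density:
  assumes \<sigma>: "0 < \<sigma>"
  shows "exp (- \<alpha> * (c - z)) * normal_density m \<sigma> z =
    exp (- \<alpha> * (c - m) + \<alpha>\<^sup>2 * \<sigma>\<^sup>2 / 2) * normal_density (m + \<alpha> * \<sigma>\<^sup>2) \<sigma> z"
proof -
  have "(z - (m + \<alpha> * \<sigma>\<^sup>2))\<^sup>2 / (2 * \<sigma>\<^sup>2) =
      \<alpha>\<^sup>2 * \<sigma>\<^sup>2 / 2 - \<alpha> * (z - m) + (z - m)\<^sup>2 / (2 * \<sigma>\<^sup>2)"
    using complete_square[of "\<sigma>\<^sup>2" "- \<alpha>" "z - m"] \<sigma> by (simp add: algebra_simps)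
  then have exponent: "- \<alpha> * (c - z) + (- (z - m)\<^sup>2 / (2 * \<sigma>\<^sup>2)) =
      (- \<alpha> * (c - m) + \<alpha>\<^sup>2 * \<sigma>\<^sup>2 / 2) + (- (z - (m + \<alpha> * \<sigma>\<^sup>2))\<^sup>2 / (2 * \<sigma>\<^sup>2))"
    by (simp add: algebra_simps)
  have "exp (- \<alpha> * (c - z)) * exp (- (z - m)\<^sup>2 / (2 * \<sigma>\<^sup>2)) =
      exp (- \<alpha> * (c - m) + \<alpha>\<^sup>2 * \<sigma>\<^sup>2 / 2) * exp (- (z - (m + \<alpha> * \<sigma>\<^sup>2))\<^sup>2 / (2 * \<sigma>\<^sup>2))"
    unfolding exp_add[symmetric] exponent ..
  moreover have "E * (n * X) = F * (n * Y)" if "E * X = F * Y" for E F X Y n :: real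
    using that by (simp add: mult.left_commute)
  ultimately show ?thesis
    unfolding normal_density_def by blast
qed

lemma integrable_bounded_times_normal_density:
  fixes f :: "real \<Rightarrow> real"
  assumes f: "f \<in> borel_measurable borel" "\<And>z. \<bar>f z\<bar> \<le> C" and \<sigma>: "0 < \<sigma>"
  shows "integrable lborel (\<lambda>z. f z * normal_density m \<sigma> z)"
proof (rule Bochner_Integration.integrable_bound)
  show "integrable lborel (\<lambda>z. C * normal_density m \<sigma> z)" using \<sigma> by simp
  show "(\<lambda>z. f z * normal_density m \<sigma> z) \<in> borel_measurable lborel" using f by simp
  show "AE z in lborel. norm (f z * normal_density m \<sigma> z) \<le> norm (C * normal_density m \<sigma> z)"
    using order_trans[OF f(2) abs_ge_self] by (intro AE_I2) (simp add: abs_mult mult_right_mono)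
qed

lemma integral_exp_tilt_below:
  assumes \<sigma>: "0 < \<sigma>"
  shows "(LINT z|lborel. of_bool (z < c) * exp (- \<alpha> * (c - z)) * normal_density m \<sigma> z) =
    exp (- \<alpha> * (c - m) + \<alpha>\<^sup>2 * \<sigma>\<^sup>2 / 2) * \<Phi> ((c - m - \<alpha> * \<sigma>\<^sup>2) / \<sigma>)"
proof -
  let ?K = "exp (- \<alpha> * (c - m) + \<alpha>\<^sup>2 * \<sigma>\<^sup>2 / 2)"
  have "of_bool (z < c) * exp (- \<alpha> * (c - z)) * normal_density m \<sigma> z =
      ?K * (of_bool (z < c) * normal_density (m + \<alpha> * \<sigma>\<^sup>2) \<sigma> z)" for z
    using exp_tilt_normal_density[OF \<sigma>, of \<alpha> c z m] by (cases "z < c") simp_all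
  then have "(LINT z|lborel. of_bool (z < c) * exp (- \<alpha> * (c - z)) * normal_density m \<sigma> z) =
      ?K * (LINT z|lborel. of_bool (z < c) * normal_density (m + \<alpha> * \<sigma>\<^sup>2) \<sigma> z)"
    by (simp only: integral_mult_right_zero)
  then show ?thesis
    unfolding integral_normal_density_below[OF \<sigma>] by (simp only: diff_diff_eq)
qed

text \<open>
  With \<open>\<alpha> = 2 b / r\<close> and \<open>c = b - \<mu> r\<close> the factor \<open>1 - exp (- \<alpha> (c - z))\<close> is the probability of staying
  below the barrier up to \<open>r\<close> given the terminal value \<open>z < c\<close>.  The bound on the tilted term makes the two parts separately integrable later on.
\<close>
lemma integral_killed_normal_density:
  assumes \<sigma>: "0 < \<sigma>" and \<alpha>: "0 \<le> \<alpha>"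
  shows "(LINT z|lborel. of_bool (z < c) * (1 - exp (- \<alpha> * (c - z))) * normal_density m \<sigma> z) =
      \<Phi> ((c - m) / \<sigma>) - exp (- \<alpha> * (c - m) + \<alpha>\<^sup>2 * \<sigma>\<^sup>2 / 2) * \<Phi> ((c - m - \<alpha> * \<sigma>\<^sup>2) / \<sigma>)" (is ?eq)
    and "exp (- \<alpha> * (c - m) + \<alpha>\<^sup>2 * \<sigma>\<^sup>2 / 2) * \<Phi> ((c - m - \<alpha> * \<sigma>\<^sup>2) / \<sigma>) \<le> 1" (is ?le)
proof -
  have bound: "\<bar>of_bool (z < c) * exp (- \<alpha> * (c - z))\<bar> \<le> 1" for z
    using \<alpha> by (auto simp: of_bool_def)
  have int1: "integrable lborel (\<lambda>z. of_bool (z < c) * normal_density m \<sigma> z)"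
    using \<sigma> by (intro integrable_bounded_times_normal_density[where C=1]) auto
  have int2: "integrable lborel (\<lambda>z. of_bool (z < c) * exp (- \<alpha> * (c - z)) * normal_density m \<sigma> z)"
    using \<sigma> bound by (intro integrable_bounded_times_normal_density[where C=1]) auto
  show ?eq
    using Bochner_Integration.integral_diff[OF int1 int2]
    by (simp only: integral_normal_density_below[OF \<sigma>] integral_exp_tilt_below[OF \<sigma>])
      (simp add: algebra_simps)
  have "(LINT z|lborel. of_bool (z < c) * exp (- \<alpha> * (c - z)) * normal_density m \<sigma> z) \<le>
      (LINT z|lborel. normal_density m \<sigma> z)"
  proof (rule integral_mono[OF int2])
    show "of_bool (z < c) * exp (- \<alpha> * (c - z)) * normal_density m \<sigma> z \<le> normal_density m \<sigma> z" for z
      using bound[of z] by (intro mult_left_le_one_le) auto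
  qed (use \<sigma> in simp)
  then show ?le
    using integral_exp_tilt_below[OF \<sigma>, of c \<alpha> m] integral_normal_density[OF \<sigma>, of m] by linarith
qed

text \<open>
  Disintegration over the endpoint: given \<open>W T = x\<close>, the value at time \<open>r\<close> has the law of the
  Brownian bridge from \<open>0\<close> to \<open>x\<close>.
\<close>
lemma normal_density_bridge:
  assumes r: "0 < r" "r < T"
  shows "normal_density 0 (sqrt r) z * normal_density 0 (sqrt (T - r)) (x - z) =
    normal_density 0 (sqrt T) x * normal_density (x * r / T) (sqrt (r * (T - r) / T)) z"
proof -
  define \<xi> y where "\<xi> = x / T" and "y = z - \<xi> * r"
  have x: "x = \<xi> * T" and z: "z = \<xi> * r + y"
    using r by (simp_all add: \<xi>_def y_def)
  then have xz: "x - z = \<xi> * (T - r) + - y"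
    by (simp add: right_diff_distrib)
  have yy: "y\<^sup>2 / (2 * r) + y\<^sup>2 / (2 * (T - r)) = y\<^sup>2 / (2 * (r * (T - r) / T))"
    using r by (simp add: divide_simps) (simp add: algebra_simps)
  have "z\<^sup>2 / (2 * r) + (x - z)\<^sup>2 / (2 * (T - r)) = \<xi>\<^sup>2 * T / 2 + y\<^sup>2 / (2 * (r * (T - r) / T))"
  proof -
    have "z\<^sup>2 / (2 * r) + (x - z)\<^sup>2 / (2 * (T - r)) =
        (\<xi>\<^sup>2 * r / 2 + \<xi> * y + y\<^sup>2 / (2 * r)) +
        (\<xi>\<^sup>2 * (T - r) / 2 + \<xi> * (- y) + (- y)\<^sup>2 / (2 * (T - r)))"
      unfolding xz using r by (subst (1 2) complete_square[symmetric]) (simp_all add: z)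
    also have "\<dots> = (\<xi>\<^sup>2 * r / 2 + \<xi>\<^sup>2 * (T - r) / 2) + (y\<^sup>2 / (2 * r) + y\<^sup>2 / (2 * (T - r)))"
      by simp
    also have "\<xi>\<^sup>2 * r / 2 + \<xi>\<^sup>2 * (T - r) / 2 = \<xi>\<^sup>2 * T / 2"
      by (simp add: right_diff_distrib diff_divide_distrib)
    finally show ?thesis unfolding yy .
  qed
  moreover have "\<xi>\<^sup>2 * T / 2 = x\<^sup>2 / (2 * T)"
    using r by (simp add: x power_mult_distrib power2_eq_square)
  moreover have "y = z - x * r / T" by (simp add: y_def \<xi>_def)
  ultimately have exponent: "- z\<^sup>2 / (2 * r) + - (x - z)\<^sup>2 / (2 * (T - r)) =
      - x\<^sup>2 / (2 * T) + - (z - x * r / T)\<^sup>2 / (2 * (r * (T - r) / T))"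
    by simp
  have "(1 / sqrt (2 * pi * r)) * (1 / sqrt (2 * pi * (T - r))) =
      (1 / sqrt (2 * pi * T)) * (1 / sqrt (2 * pi * (r * (T - r) / T)))"
    using r by (simp flip: real_sqrt_mult)
  moreover have "exp (- z\<^sup>2 / (2 * r)) * exp (- (x - z)\<^sup>2 / (2 * (T - r))) =
      exp (- x\<^sup>2 / (2 * T)) * exp (- (z - x * r / T)\<^sup>2 / (2 * (r * (T - r) / T)))"
    unfolding exp_add[symmetric] exponent ..
  moreover have "(A * B) * (C * D) = (A * C) * (B * D)" for A B C D :: real by simp
  ultimately show ?thesis
    using r by (simp add: normal_density_def) 
qed

section \<open>Independence of past and future\<close>

lemma finite_set_enumeration:
  fixes S :: "'a :: linorder set"
  assumes "finite S" "S \<noteq> {}"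
  obtains \<tau> :: "nat \<Rightarrow> 'a" and n where "mono \<tau>" "\<tau> ` {..n} = S"
proof
  define l where "l = sorted_list_of_set S"
  define n where "n = length l - 1"
  have l: "sorted l" "set l = S" "l \<noteq> []"
    using assms by (auto simp: l_def)
  show "mono (\<lambda>i. l ! min i n)"
  proof (intro monoI sorted_nth_mono l(1))
    show "min y n < length l" for y using l(3) by (cases l) (auto simp: n_def)
  qed auto
  have "(\<lambda>i. l ! min i n) ` {..n} = (\<lambda>i. l ! i) ` {..<length l}"
    using l(3) by (intro image_cong) (auto simp: n_def neq_Nil_conv)
  also have "\<dots> = S"
    using l(2) by (auto simp: set_conv_nth)
  finally show "(\<lambda>i. l ! min i n) ` {..n} = S" .
qed

lemma finite_cylinder_sets:
  assumes "finite J" "\<And>j. j \<in> J \<Longrightarrow> f j \<in> N \<rightarrow>\<^sub>M L" "\<And>j. j \<in> J \<Longrightarrow> E j \<in> sets L"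
  shows "{x \<in> space N. \<forall>j\<in>J. f j x \<in> E j} \<in> sets N"
proof -
  have "{x \<in> space N. f j x \<in> E j} \<in> sets N" if "j \<in> J" for j
    using measurable_sets[OF assms(2)[OF that] assms(3)[OF that]] by (simp add: vimage_def Int_def conj_commute)
  then show ?thesis
    using assms(1) by (intro sets.sets_Collect_finite_All) auto
qed

context standard_brownian_motion
begin

text \<open>
  The path up to time \<open>s\<close> and the path of increments after \<open>s\<close>, as elements of product spaces, so that
  the generated \<open>\<sigma>\<close>-algebras are those of the process before and after \<open>s\<close>.
\<close>
definition past :: "real \<Rightarrow> 'a \<Rightarrow> real \<Rightarrow> real"
  where "past s \<omega> = (\<lambda>u\<in>{0..s}. W u \<omega>)"

definition future :: "real \<Rightarrow> 'a \<Rightarrow> real \<Rightarrow> real"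
  where "future s \<omega> = (\<lambda>u\<in>{0..}. W (s + u) \<omega> - W s \<omega>)"

lemma measurable_past [measurable]: "past s \<in> M \<rightarrow>\<^sub>M (\<Pi>\<^sub>M u\<in>{0..s}. borel)"
  unfolding past_def by (intro measurable_restrict W_random_variable) auto

lemma measurable_future [measurable]:
  assumes "0 \<le> s"
  shows "future s \<in> M \<rightarrow>\<^sub>M (\<Pi>\<^sub>M u\<in>{0..}. borel)"
  unfolding future_def using assms
  by (intro measurable_restrict borel_measurable_diff W_random_variable) auto

text \<open>
  All times involved are listed in increasing order.  The values before \<open>s\<close> are then functions of the
  increments over the initial segment of this list, the increments after \<open>s\<close> functions of those over
  the rest, and the two blocks of increments are independent.
\<close>
lemma cylinders_past_future_indep:
  assumes s: "0 \<le> s"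
    and J: "finite J" "J \<subseteq> {0..s}" "\<And>j. j \<in> J \<Longrightarrow> E j \<in> sets borel"
    and K: "finite K" "K \<subseteq> {0..}" "\<And>k. k \<in> K \<Longrightarrow> F k \<in> sets borel"
  shows "prob ({\<omega>\<in>space M. \<forall>j\<in>J. W j \<omega> \<in> E j} \<inter>
               {\<omega>\<in>space M. \<forall>k\<in>K. W (s + k) \<omega> - W s \<omega> \<in> F k}) =
         prob {\<omega>\<in>space M. \<forall>j\<in>J. W j \<omega> \<in> E j} *
         prob {\<omega>\<in>space M. \<forall>k\<in>K. W (s + k) \<omega> - W s \<omega> \<in> F k}"
proof -
  define S where "S = {0, s} \<union> J \<union> (+) s ` K"
  have "finite S" "S \<noteq> {}" and S_nonneg: "\<And>t. t \<in> S \<Longrightarrow> 0 \<le> t"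
    using s J K by (auto simp: S_def)
  then obtain \<tau> :: "nat \<Rightarrow> real" and n where mono: "mono \<tau>" and \<tau>: "\<tau> ` {..n} = S"
    using finite_set_enumeration by metis
  have "s \<in> \<tau> ` {..n}" "0 \<in> \<tau> ` {..n}" by (auto simp: \<tau> S_def)
  then obtain m m0 where m: "m \<le> n" "\<tau> m = s" and m0: "m0 \<le> n" "\<tau> m0 = 0" by auto
  have "\<tau> 0 \<in> S" using \<tau> by auto
  then have \<tau>0: "\<tau> 0 = 0"
    using S_nonneg[of "\<tau> 0"] monoD[OF mono, of 0 m0] m0 by simp
  define X where "X i \<omega> = W (\<tau> (Suc i)) \<omega> - W (\<tau> i) \<omega>" for i \<omega>
  have ind: "indep_vars (\<lambda>_. borel) X {..<n}"
    unfolding X_def using \<tau>0 mono by (intro W_indep_increments) (auto simp: mono_iff_le_Suc)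
  have sum_X: "(\<Sum>i\<in>{a..<b}. X i \<omega>) = W (\<tau> b) \<omega> - W (\<tau> a) \<omega>" if "a \<le> b" for a b \<omega>
    unfolding X_def using that by (rule sum_Suc_diff')
  have "\<exists>i\<le>m. \<tau> i = j" if "j \<in> J" for j
  proof -
    have "j \<in> \<tau> ` {..n}" using that by (simp add: \<tau> S_def)
    then obtain i where i: "i \<le> n" "\<tau> i = j" by auto
    \<comment> \<open>the enumeration may repeat values, so a larger index can only mean \<open>j = s\<close>\<close>
    show ?thesis
    proof (cases "i \<le> m")
      case False
      then have "s \<le> j" using monoD[OF mono, of m i] i m by simp
      with that J have "j = s" by fastforce
      then show ?thesis using m by auto
    qed (use i in auto)
  qed
  then obtain ix where ix: "\<And>j. j \<in> J \<Longrightarrow> ix j \<le> m" "\<And>j. j \<in> J \<Longrightarrow> \<tau> (ix j) = j" by metis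
  have "\<exists>i. m \<le> i \<and> i \<le> n \<and> \<tau> i = s + k" if "k \<in> K" for k
  proof -
    have "s + k \<in> \<tau> ` {..n}" using that by (simp add: \<tau> S_def)
    then obtain i where i: "i \<le> n" "\<tau> i = s + k" by auto
    show ?thesis
    proof (cases "m \<le> i")
      case False
      then have "s + k \<le> s" using monoD[OF mono, of i m] i m by simp
      with that K have "k = 0" by fastforce
      then show ?thesis using m by auto
    qed (use i in auto)
  qed
  then obtain iy where iy: "\<And>k. k \<in> K \<Longrightarrow> m \<le> iy k" "\<And>k. k \<in> K \<Longrightarrow> iy k \<le> n"
      "\<And>k. k \<in> K \<Longrightarrow> \<tau> (iy k) = s + k" by metis
  have W_J: "W j \<omega> = (\<Sum>i<ix j. X i \<omega>)" if "j \<in> J" "\<omega> \<in> space M" for j \<omega>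
    using sum_X[of 0 "ix j" \<omega>] ix that \<tau>0 W_zero by (simp add: atLeast0LessThan)
  have W_K: "W (s + k) \<omega> - W s \<omega> = (\<Sum>i\<in>{m..<iy k}. X i \<omega>)" if "k \<in> K" for k \<omega>
    using sum_X[of m "iy k" \<omega>] iy that m by simp
  \<comment> \<open>the increments with index below \<open>m\<close> are those before \<open>s\<close>\<close>
  have ind2: "indep_var (PiM {..<m} (\<lambda>_. borel)) (\<lambda>\<omega>. restrict (\<lambda>i. X i \<omega>) {..<m})
                  (PiM {m..<n} (\<lambda>_. borel)) (\<lambda>\<omega>. restrict (\<lambda>i. X i \<omega>) {m..<n})"
    using m by (intro indep_var_restrict[OF ind]) auto
  define A where "A = {x\<in>space (PiM {..<m} (\<lambda>_. borel::real measure)). \<forall>j\<in>J. (\<Sum>i<ix j. x i) \<in> E j}"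
  define B where "B = {x\<in>space (PiM {m..<n} (\<lambda>_. borel::real measure)). \<forall>k\<in>K. (\<Sum>i\<in>{m..<iy k}. x i) \<in> F k}"
  have A: "A \<in> sets (PiM {..<m} (\<lambda>_. borel))"
    unfolding A_def using J ix
    by (intro finite_cylinder_sets[where L=borel] borel_measurable_sum measurable_component_singleton)
      (auto intro: order.strict_trans2)
  have B: "B \<in> sets (PiM {m..<n} (\<lambda>_. borel))"
    unfolding B_def using K iy
    by (intro finite_cylinder_sets[where L=borel] borel_measurable_sum measurable_component_singleton)
      (auto intro: order.strict_trans2)
  have eqA: "(\<lambda>\<omega>. restrict (\<lambda>i. X i \<omega>) {..<m}) -` A \<inter> space M = {\<omega>\<in>space M. \<forall>j\<in>J. W j \<omega> \<in> E j}"
  proof -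
    have "(\<Sum>i<ix j. restrict (\<lambda>i. X i \<omega>) {..<m} i) = W j \<omega>" if "j \<in> J" "\<omega> \<in> space M" for j \<omega>
      unfolding W_J[OF that] using ix(1)[OF that(1)] by (intro sum.cong) auto
    then show ?thesis by (auto simp: A_def space_PiM simp del: restrict_apply)
  qed
  have eqB: "(\<lambda>\<omega>. restrict (\<lambda>i. X i \<omega>) {m..<n}) -` B \<inter> space M =
      {\<omega>\<in>space M. \<forall>k\<in>K. W (s + k) \<omega> - W s \<omega> \<in> F k}"
  proof -
    have "(\<Sum>i\<in>{m..<iy k}. restrict (\<lambda>i. X i \<omega>) {m..<n} i) = W (s + k) \<omega> - W s \<omega>" if "k \<in> K" for k \<omega>
      unfolding W_K[OF that] using iy(2)[OF that] by (intro sum.cong) auto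
    then show ?thesis by (auto simp: B_def space_PiM simp del: restrict_apply)
  qed
  show ?thesis
    using indep_varD[OF ind2 A B]
    by (simp add: eqA[symmetric] eqB[symmetric] vimage_def Int_def conj_ac)
qed

text \<open>
  Cylinder sets form a generator that is stable under intersections, so independence extends from
  them to the whole path spaces.
\<close>
lemma past_future_indep:
  assumes s: "0 \<le> s"
  shows "indep_var (\<Pi>\<^sub>M u\<in>{0..s}. borel) (past s) (\<Pi>\<^sub>M u\<in>{0..}. borel) (future s)"
proof -
  define A where "A = {past s -` X \<inter> space M | X. X \<in> prod_algebra {0..s} (\<lambda>_. borel :: real measure)}"
  define B where "B = {future s -` X \<inter> space M | X. X \<in> prod_algebra {0..} (\<lambda>_. borel :: real measure)}"
  have past_space: "past s \<in> space M \<rightarrow> (\<Pi>\<^sub>E u\<in>{0..s}. space borel)"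
    and future_space: "future s \<in> space M \<rightarrow> (\<Pi>\<^sub>E u\<in>{0..}. space borel)"
    by (auto simp: past_def future_def)
  have A_cyl: "\<exists>J E. finite J \<and> J \<subseteq> {0..s} \<and> (\<forall>j\<in>J. E j \<in> sets borel) \<and>
      a = {\<omega>\<in>space M. \<forall>j\<in>J. W j \<omega> \<in> E j}" if a_in: "a \<in> A" for a
  proof -
    obtain X where X: "X \<in> prod_algebra {0..s} (\<lambda>_. borel :: real measure)" and a: "a = past s -` X \<inter> space M"
      using a_in by (auto simp: A_def)
    from prod_algebraE[OF X] obtain J E where J: "X = prod_emb {0..s} (\<lambda>_. borel) J (Pi\<^sub>E J E)"
      "finite J" "J \<subseteq> {0..s}" "\<And>i. i \<in> J \<Longrightarrow> E i \<in> sets borel" by metis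
    have "a = {\<omega>\<in>space M. \<forall>j\<in>J. W j \<omega> \<in> E j}"
    proof -
      have "past s \<omega> j = W j \<omega>" if "j \<in> J" for j \<omega>
        using J(3) that by (auto simp: past_def)
      then show ?thesis
        using past_space by (auto simp: a J(1) prod_emb_def PiE_iff restrict_extensional)
    qed
    with J show ?thesis by blast
  qed
  have B_cyl: "\<exists>K F. finite K \<and> K \<subseteq> {0..} \<and> (\<forall>k\<in>K. F k \<in> sets borel) \<and>
      b = {\<omega>\<in>space M. \<forall>k\<in>K. W (s + k) \<omega> - W s \<omega> \<in> F k}" if b_in: "b \<in> B" for b
  proof -
    obtain X where X: "X \<in> prod_algebra {0..} (\<lambda>_. borel :: real measure)" and b: "b = future s -` X \<inter> space M"
      using b_in by (auto simp: B_def)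
    from prod_algebraE[OF X] obtain K F where K: "X = prod_emb {0..} (\<lambda>_. borel) K (Pi\<^sub>E K F)"
      "finite K" "K \<subseteq> {0..}" "\<And>i. i \<in> K \<Longrightarrow> F i \<in> sets borel" by metis
    have "b = {\<omega>\<in>space M. \<forall>k\<in>K. W (s + k) \<omega> - W s \<omega> \<in> F k}"
    proof -
      have "future s \<omega> k = W (s + k) \<omega> - W s \<omega>" if "k \<in> K" for k \<omega>
        using K(3) that by (auto simp: future_def)
      then show ?thesis
        using future_space by (auto simp: b K(1) prod_emb_def PiE_iff restrict_extensional)
    qed
    with K show ?thesis by blast
  qed
  have prod_algebra_PiM: "X \<in> sets (PiM I N)" if "X \<in> prod_algebra I N" for X I and N :: "real \<Rightarrow> real measure"
    using that by (auto simp: sets_PiM)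
  have "indep_set A B"
  proof (rule indep_setI)
    show "A \<subseteq> events"
      unfolding A_def using measurable_sets[OF measurable_past prod_algebra_PiM] by blast
    show "B \<subseteq> events"
      unfolding B_def using measurable_sets[OF measurable_future[OF s] prod_algebra_PiM] by blast
    show "prob (a \<inter> b) = prob a * prob b" if a: "a \<in> A" and b: "b \<in> B" for a b
    proof -
      from A_cyl[OF a] obtain J E where J: "finite J \<and> J \<subseteq> {0..s} \<and> (\<forall>j\<in>J. E j \<in> sets borel) \<and>
          a = {\<omega>\<in>space M. \<forall>j\<in>J. W j \<omega> \<in> E j}"
        by (elim exE)
      then have a_eq: "a = {\<omega>\<in>space M. \<forall>j\<in>J. W j \<omega> \<in> E j}" by simp
      from B_cyl[OF b] obtain K F where K: "finite K \<and> K \<subseteq> {0..} \<and> (\<forall>k\<in>K. F k \<in> sets borel) \<and>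
          b = {\<omega>\<in>space M. \<forall>k\<in>K. W (s + k) \<omega> - W s \<omega> \<in> F k}"
        by (elim exE)
      then have b_eq: "b = {\<omega>\<in>space M. \<forall>k\<in>K. W (s + k) \<omega> - W s \<omega> \<in> F k}" by simp
      show ?thesis
        unfolding a_eq b_eq using J K by (intro cylinders_past_future_indep[OF s]) auto
    qed
  qed
  have Int_stable_vimage: "Int_stable {X -` E \<inter> space M | E. E \<in> prod_algebra I N}"
    for X :: "'a \<Rightarrow> real \<Rightarrow> real" and I N
  proof (rule Int_stableI, safe)
    fix E F assume "E \<in> prod_algebra I N" "F \<in> prod_algebra I N"
    then have "E \<inter> F \<in> prod_algebra I N"
      by (rule Int_stableD[OF Int_stable_prod_algebra])
    then show "\<exists>G. X -` E \<inter> space M \<inter> (X -` F \<inter> space M) = X -` G \<inter> space M \<and> G \<in> prod_algebra I N"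
      by (intro exI[of _ "E \<inter> F"]) auto
  qed
  have "Int_stable A" "Int_stable B"
    unfolding A_def B_def by (rule Int_stable_vimage)+
  with \<open>indep_set A B\<close> have "indep_set (sigma_sets (space M) A) (sigma_sets (space M) B)"
    by (rule indep_set_sigma_sets)
  moreover have "sigma_sets (space M) {past s -` X \<inter> space M | X. X \<in> sets (\<Pi>\<^sub>M u\<in>{0..s}. borel)}
      = sigma_sets (space M) A"
    unfolding A_def sets_PiM sigma_sets_vimage_commute[OF past_space]
    by (intro sigma_sets_sigma_sets_eq) auto
  moreover have "sigma_sets (space M) {future s -` X \<inter> space M | X. X \<in> sets (\<Pi>\<^sub>M u\<in>{0..}. borel)}
      = sigma_sets (space M) B"
    unfolding B_def sets_PiM sigma_sets_vimage_commute[OF future_space]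
    by (intro sigma_sets_sigma_sets_eq) auto
  ultimately show ?thesis
    using s by (simp add: indep_var_eq)
qed

text \<open>
  The Markov property at a deterministic time, as Fubini's theorem: the past is frozen in the outer
  expectation and the future is averaged in the inner one.
\<close>
lemma expectation_past_future:
  fixes F :: "(real \<Rightarrow> real) \<Rightarrow> (real \<Rightarrow> real) \<Rightarrow> real"
  assumes s: "0 \<le> s"
    and F[measurable]: "(\<lambda>(w, w'). F w w') \<in> borel_measurable ((\<Pi>\<^sub>M u\<in>{0..s}. borel) \<Otimes>\<^sub>M (\<Pi>\<^sub>M u\<in>{0..}. borel))"
    and bound: "\<And>w w'. \<bar>F w w'\<bar> \<le> C"
  shows "(\<lambda>\<omega>. expectation (\<lambda>\<omega>'. F (past s \<omega>) (future s \<omega>'))) \<in> borel_measurable M"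
    and "expectation (\<lambda>\<omega>. F (past s \<omega>) (future s \<omega>)) =
      expectation (\<lambda>\<omega>. expectation (\<lambda>\<omega>'. F (past s \<omega>) (future s \<omega>')))"
proof -
  note measurable_future[OF s, measurable]
  let ?S = "\<Pi>\<^sub>M u\<in>{0..s}. (borel :: real measure)" and ?T = "\<Pi>\<^sub>M u\<in>{0..}. (borel :: real measure)"
  let ?P = "distr M ?S (past s)" and ?Q = "distr M ?T (future s)"
  interpret P: prob_space ?P by (rule prob_space_distr) measurable
  interpret Q: prob_space ?Q by (rule prob_space_distr) measurable
  interpret PQ: pair_prob_space ?P ?Q ..
  have joint: "?P \<Otimes>\<^sub>M ?Q = distr M (?S \<Otimes>\<^sub>M ?T) (\<lambda>\<omega>. (past s \<omega>, future s \<omega>))"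
    using past_future_indep[OF s] by (simp add: indep_var_distribution_eq)
  have [measurable]: "(\<lambda>w. \<integral>w'. F w w' \<partial>?Q) \<in> borel_measurable ?S"
    by measurable
  have inner: "(\<integral>w'. F w w' \<partial>?Q) = expectation (\<lambda>\<omega>'. F w (future s \<omega>'))" if "w \<in> space ?S" for w
    using that by (subst integral_distr) measurable
  have inner_past: "(\<integral>w'. F (past s \<omega>) w' \<partial>?Q) = expectation (\<lambda>\<omega>'. F (past s \<omega>) (future s \<omega>'))"
    if "\<omega> \<in> space M" for \<omega>
    using inner measurable_space[OF measurable_past that] by blast
  have "(\<lambda>\<omega>. \<integral>w'. F (past s \<omega>) w' \<partial>?Q) \<in> borel_measurable M"
    by measurable
  then show "(\<lambda>\<omega>. expectation (\<lambda>\<omega>'. F (past s \<omega>) (future s \<omega>'))) \<in> borel_measurable M"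
    using inner_past by (simp cong: measurable_cong)
  have "expectation (\<lambda>\<omega>. F (past s \<omega>) (future s \<omega>)) = (\<integral>z. (case z of (w, w') \<Rightarrow> F w w') \<partial>(?P \<Otimes>\<^sub>M ?Q))"
    unfolding joint by (subst integral_distr) (auto simp: split_beta)
  also have "\<dots> = (\<integral>w. \<integral>w'. F w w' \<partial>?Q \<partial>?P)"
    using bound by (subst PQ.integral_fst'[symmetric])
      (auto intro!: PQ.integrable_const_bound[where B=C] simp: split_beta)
  also have "\<dots> = expectation (\<lambda>\<omega>. \<integral>w'. F (past s \<omega>) w' \<partial>?Q)"
    by (subst integral_distr) auto
  also have "\<dots> = expectation (\<lambda>\<omega>. expectation (\<lambda>\<omega>'. F (past s \<omega>) (future s \<omega>')))"
    using inner_past by (intro Bochner_Integration.integral_cong) auto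
  finally show "expectation (\<lambda>\<omega>. F (past s \<omega>) (future s \<omega>)) =
      expectation (\<lambda>\<omega>. expectation (\<lambda>\<omega>'. F (past s \<omega>) (future s \<omega>')))" .
qed

lemma restart_standard_brownian_motion:
  assumes s: "0 \<le> s"
  shows "standard_brownian_motion M (\<lambda>u \<omega>. W (s + u) \<omega> - W s \<omega>)"
proof (intro standard_brownian_motion.intro standard_brownian_motion_axioms.intro)
  show "prob_space M" by (fact prob_space_axioms)
  show "random_variable borel (\<lambda>\<omega>. W (s + t) \<omega> - W s \<omega>)" if "0 \<le> t" for t
    using s that by (intro borel_measurable_diff W_random_variable) auto
  show "continuous_on {0..} (\<lambda>t. W (s + t) \<omega> - W s \<omega>)" if "\<omega> \<in> space M" for \<omega>
    using s by (intro continuous_intros continuous_on_compose2[OF W_continuous[OF that]]) auto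
  show "distributed M lborel (\<lambda>\<omega>. W (s + t) \<omega> - W s \<omega> - (W (s + u) \<omega> - W s \<omega>))
      (\<lambda>x. ennreal (normal_density 0 (sqrt (t - u)) x))" if "0 \<le> u" "u < t" for u t
    using W_increment[of "s + u" "s + t"] s that by simp
  show "indep_vars (\<lambda>_. borel) (\<lambda>i \<omega>. W (s + t (Suc i)) \<omega> - W s \<omega> - (W (s + t i) \<omega> - W s \<omega>)) {..<n}"
    if "0 \<le> t 0" "\<And>i. i < n \<Longrightarrow> t i \<le> t (Suc i)" for n and t :: "nat \<Rightarrow> real"
    using W_indep_increments[of "\<lambda>i. s + t i" n] s that by simp
  show "W (s + 0) \<omega> - W s \<omega> = 0" for \<omega> by simp
qed

lemma normal_increment:
  assumes "0 \<le> s" "s < t"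
  shows "distr M borel (\<lambda>\<omega>. W t \<omega> - W s \<omega>) = density lborel (normal_density 0 (sqrt (t - s)))"
proof -
  have "distr M borel (\<lambda>\<omega>. W t \<omega> - W s \<omega>) = distr M lborel (\<lambda>\<omega>. W t \<omega> - W s \<omega>)"
    by (intro distr_cong) simp_all
  then show ?thesis
    using W_increment[OF assms] by (simp only: distributed_def)
qed

end

section \<open>Paths staying below a line\<close>

text \<open>
  A countable form of \<open>\<forall>t\<in>{0..r}. w t + \<mu> t < b\<close>, which is measurable on path space although the
  space of all functions knows nothing about continuity.  The times are multiples of \<open>r\<close>
  by rational factors, so that they are dense in \<open>{0..r}\<close> also if \<open>r = 0\<close>, and the margin \<open>1 / Suc n\<close> keeps the inequality strict
  at the remaining times.
\<close>
definition stays_below :: "real \<Rightarrow> real \<Rightarrow> real \<Rightarrow> (real \<Rightarrow> real) \<Rightarrow> bool"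
  where "stays_below \<mu> r b w \<longleftrightarrow>
    (\<exists>n. \<forall>q\<in>\<rat> \<inter> {0..1}. w (q * r) + \<mu> * (q * r) \<le> b - 1 / real (Suc n))"

lemma stays_below_cong:
  assumes "0 \<le> r" "\<And>t. 0 \<le> t \<Longrightarrow> t \<le> r \<Longrightarrow> w t = w' t"
  shows "stays_below \<mu> r b w \<longleftrightarrow> stays_below \<mu> r b w'"
proof -
  have "w (q * r) = w' (q * r)" if "q \<in> {0..1}" for q
    using that assms by (intro assms(2)) (auto intro: mult_left_le_one_le)
  then show ?thesis by (simp add: stays_below_def)
qed

text \<open>
  A continuous path attains its maximum on the compact interval, so strict inequality everywhere gives
  a uniform margin; conversely a weak inequality with a margin passes from a dense set to its
  closure.
\<close>
lemma stays_below_iff: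
  assumes r: "0 \<le> r" and w: "continuous_on {0..r} w"
  shows "stays_below \<mu> r b w \<longleftrightarrow> (\<forall>t\<in>{0..r}. w t + \<mu> * t < b)"
proof -
  define h where "h q = w (q * r) + \<mu> * (q * r)" for q
  have qr: "q * r \<in> {0..r}" if "q \<in> {0..1}" for q
    using that r by (auto intro: mult_left_le_one_le)
  have h: "continuous_on {0..1} h"
    unfolding h_def using r
    by (intro continuous_intros continuous_on_compose2[OF w]) (auto intro: mult_left_le_one_le)
  have all_h: "(\<forall>t\<in>{0..r}. w t + \<mu> * t < b) \<longleftrightarrow> (\<forall>q\<in>{0..1}. h q < b)"
  proof
    assume *: "\<forall>q\<in>{0..1}. h q < b"
    show "\<forall>t\<in>{0..r}. w t + \<mu> * t < b"
    proof
      fix t assume t: "t \<in> {0..r}"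
      show "w t + \<mu> * t < b"
      proof (cases "r = 0")
        case True
        then show ?thesis using *[rule_format, of 0] t by (simp add: h_def)
      next
        case False
        then show ?thesis using *[rule_format, of "t / r"] t r by (simp add: h_def)
      qed
    qed
  qed (use qr in \<open>auto simp: h_def\<close>)
  show ?thesis
  proof
    assume "stays_below \<mu> r b w"
    then obtain n where n: "\<And>q. q \<in> {0..1} \<inter> \<rat> \<Longrightarrow> h q \<le> b - 1 / real (Suc n)"
      unfolding stays_below_def h_def by blast
    have cl: "closure ({0..1} \<inter> \<rat>) = {0..1::real}"
    proof -
      have "closure ({0..1} \<inter> \<rat>) = closure {0..1::real}"
        by (intro closure_convex_Int_superset) (simp_all add: Rats_closure_real)
      then show ?thesis by simp
    qed
    have "h q \<le> b - 1 / real (Suc n)" if "q \<in> {0..1}" for q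
    proof (rule continuous_le_on_closure[of "{0..1} \<inter> \<rat>" h q])
      show "continuous_on (closure ({0..1} \<inter> \<rat>)) h" using h by (simp only: cl)
      show "q \<in> closure ({0..1} \<inter> \<rat>)" using that by (simp only: cl)
    qed (rule n)
    moreover have "b - 1 / real (Suc n) < b" by simp
    ultimately show "\<forall>t\<in>{0..r}. w t + \<mu> * t < b"
      unfolding all_h by (meson le_less_trans)
  next
    assume "\<forall>t\<in>{0..r}. w t + \<mu> * t < b"
    then have below: "\<forall>q\<in>{0..1}. h q < b" by (simp add: all_h)
    obtain m where m: "m \<in> {0..1}" "\<And>q. q \<in> {0..1} \<Longrightarrow> h q \<le> h m"
      using continuous_attains_sup[OF compact_Icc _ h] by auto
    then obtain n where n: "1 / real (Suc n) < b - h m"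
      using below reals_Archimedean[of "b - h m"] by (auto simp: inverse_eq_divide)
    have "h q \<le> b - 1 / real (Suc n)" if "q \<in> {0..1}" for q
      using m(2)[OF that] n by linarith
    then show "stays_below \<mu> r b w"
      unfolding stays_below_def h_def by blast
  qed
qed

lemma measurable_stays_below [measurable (raw)]:
  assumes r: "0 \<le> r" "{0..r} \<subseteq> I"
    and f[measurable]: "f \<in> borel_measurable N"
    and X[measurable]: "X \<in> N \<rightarrow>\<^sub>M (\<Pi>\<^sub>M u\<in>I. borel)"
  shows "Measurable.pred N (\<lambda>z. stays_below \<mu> r (f z) (X z))"
proof -
  have "q * r \<in> I" if "q \<in> \<rat> \<inter> {0..1}" for q
    using that r by (auto intro!: subsetD[OF r(2)] intro: mult_left_le_one_le)
  then have [measurable]: "(\<lambda>z. X z (q * r)) \<in> borel_measurable N" if "q \<in> \<rat> \<inter> {0..1}" for q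
    using that by (intro measurable_compose[OF X] measurable_component_singleton) auto
  have "{z \<in> space N. \<forall>q\<in>\<rat> \<inter> {0..1}. X z (q * r) + \<mu> * (q * r) \<le> f z - 1 / real (Suc n)} \<in> sets N" for n
    by (intro sets.sets_Collect_countable_All' countable_Int1 countable_rat) measurable
  then have [measurable]:
    "Measurable.pred N (\<lambda>z. \<forall>q\<in>\<rat> \<inter> {0..1}. X z (q * r) + \<mu> * (q * r) \<le> f z - 1 / real (Suc n))" for n
    by (simp add: pred_def)
  then show ?thesis
    unfolding stays_below_def by measurable
qed

section \<open>The reflection identity at the hitting time\<close>

context standard_brownian_motion
begin

lemma borel_measurable_W [measurable]: "0 \<le> t \<Longrightarrow> W t \<in> borel_measurable M"
  by (rule W_random_variable)

definition gap :: "real \<Rightarrow> real \<Rightarrow> real \<Rightarrow> 'a \<Rightarrow> real"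
  where "gap \<mu> b t \<omega> = b - \<mu> * t - W t \<omega>"

definition unhit :: "real \<Rightarrow> real \<Rightarrow> real \<Rightarrow> 'a \<Rightarrow> bool"
  where "unhit \<mu> b t \<omega> = stays_below \<mu> t b (\<lambda>u. W u \<omega>)"

lemma unhit_iff:
  assumes "0 \<le> t" "\<omega> \<in> space M"
  shows "unhit \<mu> b t \<omega> \<longleftrightarrow> (\<forall>u\<in>{0..t}. 0 < gap \<mu> b u \<omega>)"
proof -
  have "continuous_on {0..t} (\<lambda>u. W u \<omega>)"
    using W_continuous[OF assms(2)] by (rule continuous_on_subset) auto
  from stays_below_iff[OF assms(1) this] show ?thesis
    by (auto simp: unhit_def gap_def algebra_simps)
qed

lemma stays_below_past:
  assumes "0 \<le> t" "t \<le> s"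
  shows "stays_below \<mu> t b (past s \<omega>) \<longleftrightarrow> unhit \<mu> b t \<omega>"
  unfolding unhit_def using assms by (intro stays_below_cong) (auto simp: past_def)

lemma measurable_unhit [measurable]:
  assumes "0 \<le> t"
  shows "Measurable.pred M (unhit \<mu> b t)"
proof -
  have "Measurable.pred M (\<lambda>\<omega>. stays_below \<mu> t b (past t \<omega>))"
    using assms by (intro measurable_stays_below[where I = "{0..t}"]) auto
  then show ?thesis
    using assms by (simp add: stays_below_past cong: measurable_cong)
qed

lemma measurable_gap [measurable]: "0 \<le> t \<Longrightarrow> gap \<mu> b t \<in> borel_measurable M"
  unfolding gap_def by measurable

text \<open>
  If \<open>G\<close> of a path restarted from gap \<open>0\<close> has mean zero, then restarting from gap \<open>y\<close> gives a mean of
  order \<open>\<bar>y\<bar>\<close> by the Lipschitz bound.  With \<open>B\<close> the event that the barrier is first hit in one grid cell and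
  \<open>s\<close> the right end of the cell, the gap at \<open>s\<close> is small, and so is the contribution of \<open>B\<close>.
\<close>
lemma past_event_gap_bound:
  fixes G :: "real \<Rightarrow> real"
  assumes G[measurable]: "G \<in> borel_measurable borel"
    and bound: "\<And>y. \<bar>G y\<bar> \<le> C" and lipschitz: "\<And>x y. \<bar>G x - G y\<bar> \<le> L * \<bar>x - y\<bar>"
    and s: "0 \<le> s" "s \<le> r"
    and vanish: "expectation (\<lambda>\<omega>. G (- (W r \<omega> - W s \<omega>) - \<mu> * (r - s))) = 0"
    and B[measurable]: "Measurable.pred (\<Pi>\<^sub>M u\<in>{0..s}. borel) B"
  shows "\<bar>expectation (\<lambda>\<omega>. of_bool (B (past s \<omega>)) * G (gap \<mu> b r \<omega>))\<bar> \<le>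
    expectation (\<lambda>\<omega>. of_bool (B (past s \<omega>)) * min C (L * \<bar>gap \<mu> b s \<omega>\<bar>))"
proof -
  have [measurable]: "W s \<in> borel_measurable M" "W r \<in> borel_measurable M"
    "gap \<mu> b s \<in> borel_measurable M" "gap \<mu> b r \<in> borel_measurable M"
    using s by (auto intro: W_random_variable)
  have C: "0 \<le> C" using bound[of 0] by linarith
  define V where "V \<omega> = - (W r \<omega> - W s \<omega>) - \<mu> * (r - s)" for \<omega>
  have [measurable]: "V \<in> borel_measurable M" unfolding V_def by measurable
  \<comment> \<open>mean of \<open>G\<close> at time \<open>r\<close> when the gap at time \<open>s\<close> is \<open>y\<close>\<close>
  define h where "h y = expectation (\<lambda>\<omega>. G (y + V \<omega>))" for y
  have int_G: "integrable M (\<lambda>\<omega>. G (y + V \<omega>))" for y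
    using bound by (intro integrable_const_bound[where B=C]) auto
  have h_C: "\<bar>h y\<bar> \<le> C" for y
  proof -
    have "\<bar>h y\<bar> \<le> expectation (\<lambda>\<omega>. \<bar>G (y + V \<omega>)\<bar>)"
      unfolding h_def by (rule integral_abs_bound)
    also have "\<dots> \<le> expectation (\<lambda>_. C)"
      using bound int_G by (intro integral_mono integrable_abs) auto
    finally show ?thesis by (simp add: prob_space)
  qed
  have h_L: "\<bar>h y\<bar> \<le> L * \<bar>y\<bar>" for y
  proof -
    have "h y = h y - expectation (\<lambda>\<omega>. G (0 + V \<omega>))"
      using vanish by (simp add: V_def)
    also have "\<dots> = expectation (\<lambda>\<omega>. G (y + V \<omega>) - G (0 + V \<omega>))"
      unfolding h_def by (rule Bochner_Integration.integral_diff[symmetric]) (rule int_G)+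
    finally have "\<bar>h y\<bar> \<le> expectation (\<lambda>\<omega>. \<bar>G (y + V \<omega>) - G (0 + V \<omega>)\<bar>)"
      by (simp only: integral_abs_bound)
    also have "\<dots> \<le> expectation (\<lambda>_. L * \<bar>y\<bar>)"
    proof (rule integral_mono)
      show "integrable M (\<lambda>\<omega>. \<bar>G (y + V \<omega>) - G (0 + V \<omega>)\<bar>)"
        by (intro integrable_abs Bochner_Integration.integrable_diff int_G)
      show "\<bar>G (y + V \<omega>) - G (0 + V \<omega>)\<bar> \<le> L * \<bar>y\<bar>" for \<omega>
        using lipschitz[of "y + V \<omega>" "0 + V \<omega>"] by simp
    qed simp
    finally show ?thesis by (simp add: prob_space)
  qed
  define F where "F w w' = of_bool (B w) * G (b - \<mu> * r - w s - w' (r - s))" for w w' :: "real \<Rightarrow> real"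
  have F_past_future: "F (past s \<omega>) (future s \<omega>') =
      of_bool (B (past s \<omega>)) * G (gap \<mu> b s \<omega> + V \<omega>')" for \<omega> \<omega>'
    using s by (simp add: F_def past_def future_def gap_def V_def algebra_simps)
  have [measurable]: "(\<lambda>w. w s) \<in> borel_measurable (\<Pi>\<^sub>M u\<in>{0..s}. borel)"
    "(\<lambda>w. w (r - s)) \<in> borel_measurable (\<Pi>\<^sub>M u\<in>{0..}. borel)"
    using s by (auto intro!: measurable_component_singleton)
  have F_meas: "(\<lambda>(w, w'). F w w') \<in> borel_measurable ((\<Pi>\<^sub>M u\<in>{0..s}. borel) \<Otimes>\<^sub>M (\<Pi>\<^sub>M u\<in>{0..}. borel))"
    unfolding F_def by measurable
  have F_bound: "\<bar>F w w'\<bar> \<le> C" for w w'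
    using bound C by (simp add: F_def of_bool_def)
  have "expectation (\<lambda>\<omega>. of_bool (B (past s \<omega>)) * G (gap \<mu> b r \<omega>)) =
      expectation (\<lambda>\<omega>. F (past s \<omega>) (future s \<omega>))"
    unfolding F_past_future by (simp add: gap_def V_def algebra_simps)
  also have "\<dots> = expectation (\<lambda>\<omega>. expectation (\<lambda>\<omega>'. F (past s \<omega>) (future s \<omega>')))"
    by (rule expectation_past_future(2)[OF s(1) F_meas F_bound])
  also have "\<dots> = expectation (\<lambda>\<omega>. of_bool (B (past s \<omega>)) * h (gap \<mu> b s \<omega>))"
    unfolding F_past_future by (simp add: h_def)
  finally have eq: "expectation (\<lambda>\<omega>. of_bool (B (past s \<omega>)) * G (gap \<mu> b r \<omega>)) =
    expectation (\<lambda>\<omega>. of_bool (B (past s \<omega>)) * h (gap \<mu> b s \<omega>))" .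
  have Bh: "(\<lambda>\<omega>. of_bool (B (past s \<omega>)) * h (gap \<mu> b s \<omega>)) \<in> borel_measurable M"
    using expectation_past_future(1)[OF s(1) F_meas F_bound]
    unfolding F_past_future by (simp add: h_def)
  have int1: "integrable M (\<lambda>\<omega>. of_bool (B (past s \<omega>)) * h (gap \<mu> b s \<omega>))"
    by (rule integrable_const_bound[where B=C, OF _ Bh]) (use h_C C in \<open>auto simp: of_bool_def\<close>)
  have int2: "integrable M (\<lambda>\<omega>. of_bool (B (past s \<omega>)) * min C (L * \<bar>gap \<mu> b s \<omega>\<bar>))"
  proof (rule integrable_const_bound[where B=C])
    have "0 \<le> L * \<bar>y\<bar>" for y using h_L[of y] abs_ge_zero[of "h y"] by linarith
    then show "AE \<omega> in M. norm (of_bool (B (past s \<omega>)) * min C (L * \<bar>gap \<mu> b s \<omega>\<bar>)) \<le> C"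
      using C by (intro AE_I2) (simp add: of_bool_def)
  qed measurable
  have "\<bar>expectation (\<lambda>\<omega>. of_bool (B (past s \<omega>)) * h (gap \<mu> b s \<omega>))\<bar> \<le>
      expectation (\<lambda>\<omega>. \<bar>of_bool (B (past s \<omega>)) * h (gap \<mu> b s \<omega>)\<bar>)"
    by (rule integral_abs_bound)
  also have "\<dots> \<le> expectation (\<lambda>\<omega>. of_bool (B (past s \<omega>)) * min C (L * \<bar>gap \<mu> b s \<omega>\<bar>))"
    using h_C h_L by (intro integral_mono integrable_abs int1 int2) (simp add: of_bool_def)
  finally show ?thesis unfolding eq .
qed

lemma unhit_antimono: "0 \<le> s \<Longrightarrow> s \<le> t \<Longrightarrow> \<omega> \<in> space M \<Longrightarrow> unhit \<mu> b t \<omega> \<Longrightarrow> unhit \<mu> b s \<omega>"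
  by (auto simp: unhit_iff)

lemma unhit_0: "\<omega> \<in> space M \<Longrightarrow> unhit \<mu> b 0 \<omega> \<longleftrightarrow> 0 < b"
  by (simp add: unhit_iff gap_def W_zero)

lemma continuous_on_gap: "\<omega> \<in> space M \<Longrightarrow> continuous_on {0..r} (\<lambda>t. gap \<mu> b t \<omega>)"
  unfolding gap_def
  by (intro continuous_intros continuous_on_subset[OF W_continuous]) auto

lemma gap_zero_between:
  assumes st: "0 \<le> s" "s \<le> t" and \<omega>: "\<omega> \<in> space M"
    and hit: "unhit \<mu> b s \<omega>" "\<not> unhit \<mu> b t \<omega>"
  obtains u where "s \<le> u" "u \<le> t" "gap \<mu> b u \<omega> = 0"
proof -
  obtain z where z: "0 \<le> z" "z \<le> t" "gap \<mu> b z \<omega> \<le> 0"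
    using hit(2) st \<omega> by (auto simp: unhit_iff not_less)
  have pos: "0 < gap \<mu> b s \<omega>" and "s < z"
    using hit(1) st \<omega> z by (auto simp: unhit_iff not_less[symmetric])
  have "continuous_on {s..z} (\<lambda>t. gap \<mu> b t \<omega>)"
    using continuous_on_gap[OF \<omega>, of z \<mu> b] by (rule continuous_on_subset) (use st in auto)
  then obtain u where "s \<le> u" "u \<le> z" "gap \<mu> b u \<omega> = 0"
    using IVT2'[of "\<lambda>t. gap \<mu> b t \<omega>" z 0 s] z pos \<open>s < z\<close> by auto
  with z show ?thesis by (intro that) auto
qed

text \<open>
  The event of a hit is split according to the grid cell of the first hit, and the Markov property is
  used at the right end of that cell.  At the first hit the gap is zero, so at the end of the cell it
  is bounded by the oscillation of the path over one mesh width.  The sum of the errors is bounded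
  and tends to zero along each path.
\<close>
lemma hitting_reflection:
  fixes G :: "real \<Rightarrow> real"
  assumes G[measurable]: "G \<in> borel_measurable borel"
    and bound: "\<And>y. \<bar>G y\<bar> \<le> C" and lipschitz: "\<And>x y. \<bar>G x - G y\<bar> \<le> L * \<bar>x - y\<bar>"
    and b: "0 < b" and r: "0 \<le> r"
    and vanish: "\<And>s. 0 \<le> s \<Longrightarrow> s \<le> r \<Longrightarrow>
      expectation (\<lambda>\<omega>. G (- (W r \<omega> - W s \<omega>) - \<mu> * (r - s))) = 0"
  shows "expectation (\<lambda>\<omega>. of_bool (\<not> unhit \<mu> b r \<omega>) * G (gap \<mu> b r \<omega>)) = 0"
proof -
  have C: "0 \<le> C" using bound[of 0] by linarith
  have L: "0 \<le> L" using lipschitz[of 1 0] by simp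
  \<comment> \<open>\<open>Suc N\<close> cells, so that there is always at least one\<close>
  define t where "t N k = real k * r / real (Suc N)" for N k :: nat
  have t_nonneg: "0 \<le> t N k" for N k using r by (simp add: t_def)
  have t_mono: "t N k \<le> t N (Suc k)" for N k
    using r by (auto simp: t_def intro!: divide_right_mono mult_right_mono)
  have t_0: "t N 0 = 0" and t_end: "t N (Suc N) = r" for N by (simp_all add: t_def)
  have t_le: "t N k \<le> r" if "k \<le> Suc N" for N k
  proof -
    have "real k * r \<le> real (Suc N) * r" using that r by (intro mult_right_mono) auto
    then show ?thesis by (simp add: t_def pos_divide_le_eq mult.commute del: of_nat_Suc)
  qed
  define first where "first N k \<omega> \<longleftrightarrow> unhit \<mu> b (t N k) \<omega> \<and> \<not> unhit \<mu> b (t N (Suc k)) \<omega>" for N k \<omega>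
  have [measurable]: "Measurable.pred M (first N k)" for N k
    unfolding first_def using t_nonneg by measurable
  have [measurable]: "unhit \<mu> b r \<in> M \<rightarrow>\<^sub>M count_space UNIV" "gap \<mu> b r \<in> borel_measurable M"
    "gap \<mu> b (t N k) \<in> borel_measurable M" for N k
    using r t_nonneg by measurable
  have sum_first: "(\<Sum>k<Suc N. of_bool (first N k \<omega>)) = (of_bool (\<not> unhit \<mu> b r \<omega>) :: real)"
    if "\<omega> \<in> space M" for N \<omega>
  proof -
    have "of_bool (first N k \<omega>) = of_bool (unhit \<mu> b (t N k) \<omega>) - (of_bool (unhit \<mu> b (t N (Suc k)) \<omega>) :: real)" for k
      using unhit_antimono[OF t_nonneg t_mono that, of \<mu> b N k] by (auto simp: first_def)
    then have "(\<Sum>k<Suc N. of_bool (first N k \<omega>)) =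
        of_bool (unhit \<mu> b (t N 0) \<omega>) - (of_bool (unhit \<mu> b (t N (Suc N)) \<omega>) :: real)"
      by (simp only: sum_lessThan_telescope'[of "\<lambda>k. of_bool (unhit \<mu> b (t N k) \<omega>) :: real"])
    then show ?thesis using b that by (simp only: t_0 t_end unhit_0) simp
  qed
  \<comment> \<open>total error of the Markov property at the ends of the cells of first hit\<close>
  define R where "R N \<omega> = (\<Sum>k<Suc N. of_bool (first N k \<omega>) * min C (L * \<bar>gap \<mu> b (t N (Suc k)) \<omega>\<bar>))" for N \<omega>
  have R_meas[measurable]: "R N \<in> borel_measurable M" for N
    unfolding R_def by measurable
  have R_nonneg: "0 \<le> R N \<omega>" for N \<omega>
    unfolding R_def using C L by (intro sum_nonneg) simp
  have R_le: "R N \<omega> \<le> e" if "\<omega> \<in> space M" "0 \<le> e"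
    "\<And>k. k < Suc N \<Longrightarrow> first N k \<omega> \<Longrightarrow> min C (L * \<bar>gap \<mu> b (t N (Suc k)) \<omega>\<bar>) \<le> e" for N \<omega> e
  proof -
    have "R N \<omega> \<le> (\<Sum>k<Suc N. of_bool (first N k \<omega>) * e)"
      unfolding R_def using that(3) by (intro sum_mono) auto
    also have "\<dots> = of_bool (\<not> unhit \<mu> b r \<omega>) * e"
      by (simp only: sum_distrib_right[symmetric] sum_first[OF that(1)])
    also have "\<dots> \<le> e" using that(2) by simp
    finally show ?thesis .
  qed
  have R_C: "R N \<omega> \<le> C" if "\<omega> \<in> space M" for N \<omega>
    using C that by (intro R_le) auto
  have bound_R: "\<bar>expectation (\<lambda>\<omega>. of_bool (\<not> unhit \<mu> b r \<omega>) * G (gap \<mu> b r \<omega>))\<bar> \<le> expectation (R N)" for N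
  proof -
    have intG: "integrable M (\<lambda>\<omega>. of_bool (first N k \<omega>) * G (gap \<mu> b r \<omega>))" for k
      using bound C by (intro integrable_const_bound[where B=C]) (auto simp: of_bool_def)
    have intR: "integrable M (\<lambda>\<omega>. of_bool (first N k \<omega>) * min C (L * \<bar>gap \<mu> b (t N (Suc k)) \<omega>\<bar>))" for k
      using C L by (intro integrable_const_bound[where B=C]) (auto simp: of_bool_def)
    have "expectation (\<lambda>\<omega>. of_bool (\<not> unhit \<mu> b r \<omega>) * G (gap \<mu> b r \<omega>)) =
        expectation (\<lambda>\<omega>. \<Sum>k<Suc N. of_bool (first N k \<omega>) * G (gap \<mu> b r \<omega>))"
      by (intro Bochner_Integration.integral_cong refl)
        (simp only: sum_distrib_right[symmetric] sum_first)
    also have "\<dots> = (\<Sum>k<Suc N. expectation (\<lambda>\<omega>. of_bool (first N k \<omega>) * G (gap \<mu> b r \<omega>)))"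
      using intG by (intro Bochner_Integration.integral_sum)
    finally have "\<bar>expectation (\<lambda>\<omega>. of_bool (\<not> unhit \<mu> b r \<omega>) * G (gap \<mu> b r \<omega>))\<bar> \<le>
        (\<Sum>k<Suc N. \<bar>expectation (\<lambda>\<omega>. of_bool (first N k \<omega>) * G (gap \<mu> b r \<omega>))\<bar>)"
      by (simp only: sum_abs)
    also have "\<dots> \<le> (\<Sum>k<Suc N. expectation (\<lambda>\<omega>. of_bool (first N k \<omega>) * min C (L * \<bar>gap \<mu> b (t N (Suc k)) \<omega>\<bar>)))"
    proof (rule sum_mono)
      fix k assume "k \<in> {..<Suc N}"
      then have k: "t N (Suc k) \<le> r" by (intro t_le) auto
      define B where "B w \<longleftrightarrow> stays_below \<mu> (t N k) b w \<and> \<not> stays_below \<mu> (t N (Suc k)) b w" for w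
      have B_meas: "Measurable.pred (\<Pi>\<^sub>M u\<in>{0..t N (Suc k)}. borel) B"
        unfolding B_def using t_nonneg t_mono[of N k]
        by (intro pred_intros_logic measurable_stays_below[where I="{0..t N (Suc k)}"]) auto
      have B_first: "B (past (t N (Suc k)) \<omega>) = first N k \<omega>" for \<omega>
        using t_nonneg t_mono[of N k] by (simp add: B_def first_def stays_below_past)
      show "\<bar>expectation (\<lambda>\<omega>. of_bool (first N k \<omega>) * G (gap \<mu> b r \<omega>))\<bar> \<le>
          expectation (\<lambda>\<omega>. of_bool (first N k \<omega>) * min C (L * \<bar>gap \<mu> b (t N (Suc k)) \<omega>\<bar>))"
        using past_event_gap_bound[OF G bound lipschitz t_nonneg k vanish[OF t_nonneg k] B_meas]
        by (simp only: B_first)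
    qed
    also have "\<dots> = expectation (R N)"
      unfolding R_def using intR by (intro Bochner_Integration.integral_sum[symmetric])
    finally show ?thesis .
  qed
  have R_lim: "(\<lambda>N. R N \<omega>) \<longlonglongrightarrow> 0" if \<omega>: "\<omega> \<in> space M" for \<omega>
  proof (rule LIMSEQ_I)
    fix e :: real assume e: "0 < e"
    \<comment> \<open>\<open>L\<close> may be zero, hence \<open>L + 1\<close> in the denominator\<close>
    define \<epsilon> where "\<epsilon> = e / (2 * (L + 1))"
    have \<epsilon>: "0 < \<epsilon>" "L * \<epsilon> < e"
    proof -
      show "0 < \<epsilon>" using e L by (simp add: \<epsilon>_def)
      have "L * e \<le> (L + 1) * e" using e by (intro mult_right_mono) auto
      also have "\<dots> < (2 * (L + 1)) * e" using e L by (intro mult_strict_right_mono) auto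
      finally show "L * \<epsilon> < e" using L by (simp add: \<epsilon>_def pos_divide_less_eq mult.commute)
    qed
    have "uniformly_continuous_on {0..r} (\<lambda>u. gap \<mu> b u \<omega>)"
      by (intro compact_uniformly_continuous continuous_on_gap \<omega>) simp
    then obtain \<delta> where \<delta>: "0 < \<delta>"
      "\<And>u u'. u \<in> {0..r} \<Longrightarrow> u' \<in> {0..r} \<Longrightarrow> dist u' u < \<delta> \<Longrightarrow> dist (gap \<mu> b u' \<omega>) (gap \<mu> b u \<omega>) < \<epsilon>"
      using \<epsilon>(1) unfolding uniformly_continuous_on_def by metis
    obtain N0 where N0: "r / \<delta> < real N0" using reals_Archimedean2 by blast
    have "norm (R N \<omega> - 0) < e" if "N0 \<le> N" for N
    proof -
      have "r / \<delta> < real (Suc N)" using N0 that by simp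
      then have mesh: "r / real (Suc N) < \<delta>"
        using \<delta>(1) by (simp add: pos_divide_less_eq mult.commute)
      have "R N \<omega> \<le> L * \<epsilon>"
      proof (rule R_le[OF \<omega>])
        fix k assume k: "k < Suc N" and "first N k \<omega>"
        then obtain u where u: "t N k \<le> u" "u \<le> t N (Suc k)" "gap \<mu> b u \<omega> = 0"
          using gap_zero_between[OF t_nonneg t_mono \<omega>] unfolding first_def by metis
        have "t N (Suc k) - t N k = r / real (Suc N)"
          unfolding t_def diff_divide_distrib[symmetric] by (simp add: left_diff_distrib[symmetric])
        then have "dist (t N (Suc k)) u < \<delta>" using u mesh by (simp add: dist_real_def)
        moreover have "0 \<le> u" "u \<le> r" "t N (Suc k) \<le> r"
          using u t_nonneg[of N k] t_le[of "Suc k" N] k by auto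
        ultimately have "\<bar>gap \<mu> b (t N (Suc k)) \<omega>\<bar> < \<epsilon>"
          using \<delta>(2)[of u "t N (Suc k)"] u(3) t_nonneg by (simp add: dist_real_def)
        then show "min C (L * \<bar>gap \<mu> b (t N (Suc k)) \<omega>\<bar>) \<le> L * \<epsilon>"
          using L by (intro min.coboundedI2 mult_left_mono) auto
      qed (use L \<epsilon> in simp)
      then show ?thesis using \<epsilon>(2) R_nonneg[of N \<omega>] by simp
    qed
    then show "\<exists>N0. \<forall>N\<ge>N0. norm (R N \<omega> - 0) < e" by blast
  qed
  have "(\<lambda>N. expectation (R N)) \<longlonglongrightarrow> expectation (\<lambda>_. 0)"
  proof (rule integral_dominated_convergence[where w="\<lambda>_. C"])
    show "AE \<omega> in M. (\<lambda>N. R N \<omega>) \<longlonglongrightarrow> 0" using R_lim by (rule AE_I2)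
    show "AE \<omega> in M. norm (R N \<omega>) \<le> C" for N
      using R_C R_nonneg by (intro AE_I2) simp
  qed simp_all
  then have "\<bar>expectation (\<lambda>\<omega>. of_bool (\<not> unhit \<mu> b r \<omega>) * G (gap \<mu> b r \<omega>))\<bar> \<le> 0"
    by (intro LIMSEQ_le_const[where X="\<lambda>N. expectation (R N)"]) (auto simp: bound_R)
  then show ?thesis by simp
qed

end

section \<open>Reflected test functions\<close>

text \<open>
  Lipschitz approximations of the indicator of \<open>{c<..}\<close>.
\<close>
definition ramp :: "real \<Rightarrow> nat \<Rightarrow> real \<Rightarrow> real"
  where "ramp c n d = min 1 (real n * max 0 (d - c))"

lemma ramp_bounds: "0 \<le> ramp c n d" "ramp c n d \<le> 1"
  by (simp_all add: ramp_def)

lemma ramp_eq_0: "d \<le> c \<Longrightarrow> ramp c n d = 0"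
  by (simp add: ramp_def)

lemma ramp_lipschitz: "\<bar>ramp c n x - ramp c n y\<bar> \<le> real n * \<bar>x - y\<bar>"
proof -
  have "\<bar>ramp c n x - ramp c n y\<bar> \<le> \<bar>real n * max 0 (x - c) - real n * max 0 (y - c)\<bar>"
    unfolding ramp_def by linarith
  also have "\<dots> = real n * \<bar>max 0 (x - c) - max 0 (y - c)\<bar>"
    by (simp add: abs_mult right_diff_distrib[symmetric])
  also have "\<dots> \<le> real n * \<bar>x - y\<bar>"
    by (intro mult_left_mono) auto
  finally show ?thesis .
qed

lemma borel_measurable_ramp [measurable]: "ramp c n \<in> borel_measurable borel"
  unfolding ramp_def by measurable

lemma ramp_tendsto: "(\<lambda>n. ramp c n d) \<longlonglongrightarrow> of_bool (c < d)"
proof (cases "c < d")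
  case True
  obtain N where N: "1 / (d - c) < real N" using reals_Archimedean2 by blast
  have "ramp c n d = 1" if "N \<le> n" for n
  proof -
    have "1 / (d - c) \<le> real n" using N that by linarith
    then have "1 \<le> real n * (d - c)" using True by (simp add: pos_divide_le_eq)
    then show ?thesis using True by (simp add: ramp_def)
  qed
  then have "eventually (\<lambda>n. ramp c n d = 1) sequentially"
    by (auto simp: eventually_sequentially)
  then show ?thesis using True by (simp add: tendsto_eventually)
next
  case False
  then show ?thesis by (simp add: ramp_eq_0)
qed

lemma exp_lipschitz_nonpos:
  fixes x y :: real
  assumes "x \<le> 0" "y \<le> 0"
  shows "\<bar>exp x - exp y\<bar> \<le> \<bar>x - y\<bar>"
proof -
  have *: "exp v - exp u \<le> v - u" if "u \<le> v" "v \<le> 0" for u v :: real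
  proof -
    have "exp v - exp u = exp v * (1 - exp (u - v))"
      by (simp add: right_diff_distrib exp_add[symmetric])
    also have "\<dots> \<le> 1 * (1 - exp (u - v))"
      using that by (intro mult_right_mono) auto
    also have "\<dots> \<le> v - u"
    proof -
      have "1 * (1 - e) \<le> v - u" if "1 + (u - v) \<le> e" for e using that by simp
      from this[OF exp_ge_add_one_self] show ?thesis .
    qed
    finally show ?thesis .
  qed
  show ?thesis
  proof (cases "x \<le> y")
    case True
    then have "exp x \<le> exp y" by simp
    then show ?thesis using *[of x y] True assms by linarith
  next
    case False
    then have "exp y \<le> exp x" by simp
    then show ?thesis using *[of y x] False assms by linarith
  qed
qed

text \<open>
  For \<open>f\<close> supported on the positive half-line this is \<open>f\<close> there, and on the negative half-line minus
  the reflection of \<open>f\<close> weighted by the ratio \<open>exp (2 \<mu> d)\<close> of the two densities.  The minimum with \<open>0\<close>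
  changes no value for such \<open>f\<close> and keeps the weight bounded and Lipschitz.
\<close>
definition odd_reflection :: "real \<Rightarrow> (real \<Rightarrow> real) \<Rightarrow> real \<Rightarrow> real"
  where "odd_reflection \<mu> f d = f d - f (- d) * exp (2 * \<mu> * min d 0)"

lemma odd_reflection_lipschitz:
  assumes \<mu>: "0 \<le> \<mu>" and f: "\<And>x. 0 \<le> f x" "\<And>x. f x \<le> 1" "\<And>x y. \<bar>f x - f y\<bar> \<le> L * \<bar>x - y\<bar>"
  shows "\<bar>odd_reflection \<mu> f x - odd_reflection \<mu> f y\<bar> \<le> (2 * L + 2 * \<mu>) * \<bar>x - y\<bar>"
proof -
  define e where "e d = exp (2 * \<mu> * min d 0)" for d
  have arg: "2 * \<mu> * min d 0 \<le> 0" for d using \<mu> by (simp add: mult_nonneg_nonpos)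
  have e: "0 \<le> e d" "e d \<le> 1" for d using arg[of d] by (simp_all add: e_def)
  have "\<bar>e x - e y\<bar> \<le> \<bar>2 * \<mu> * min x 0 - 2 * \<mu> * min y 0\<bar>"
    unfolding e_def by (rule exp_lipschitz_nonpos[OF arg arg])
  also have "\<dots> = 2 * \<mu> * \<bar>min x 0 - min y 0\<bar>"
    using \<mu> by (simp only: right_diff_distrib[symmetric] abs_mult)
  also have "\<dots> \<le> 2 * \<mu> * \<bar>x - y\<bar>" using \<mu> by (intro mult_left_mono) auto
  finally have e_lip: "\<bar>e x - e y\<bar> \<le> 2 * \<mu> * \<bar>x - y\<bar>" .
  have "odd_reflection \<mu> f x - odd_reflection \<mu> f y =
      (f x - f y) - (f (- x) - f (- y)) * e x - f (- y) * (e x - e y)"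
    by (simp add: odd_reflection_def e_def algebra_simps)
  also have "\<bar>\<dots>\<bar> \<le> \<bar>f x - f y\<bar> + \<bar>(f (- x) - f (- y)) * e x\<bar> + \<bar>f (- y) * (e x - e y)\<bar>"
    by linarith
  also have "\<bar>(f (- x) - f (- y)) * e x\<bar> \<le> \<bar>f (- x) - f (- y)\<bar>"
    using e[of x] by (simp add: abs_mult mult_left_le)
  also have "\<bar>f (- y) * (e x - e y)\<bar> \<le> \<bar>e x - e y\<bar>"
    using f(1,2)[of "- y"] by (simp add: abs_mult mult_left_le_one_le)
  finally show ?thesis
    using f(3)[of x y] f(3)[of "- x" "- y"] e_lip by (simp add: algebra_simps abs_minus_commute)
qed

lemma odd_reflection_bound:
  assumes \<mu>: "0 \<le> \<mu>" and f: "\<And>x. 0 \<le> f x" "\<And>x. f x \<le> 1"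
  shows "\<bar>odd_reflection \<mu> f d\<bar> \<le> 1"
proof -
  have "exp (2 * \<mu> * min d 0) \<le> 1" using \<mu> by (simp add: mult_nonneg_nonpos)
  then have "0 \<le> f (- d) * exp (2 * \<mu> * min d 0)" "f (- d) * exp (2 * \<mu> * min d 0) \<le> 1"
    using f(1,2)[of "- d"] by (simp_all add: mult_le_one)
  then show ?thesis using f(1,2)[of d] by (simp add: odd_reflection_def)
qed

text \<open>
  The points \<open>x\<close> and \<open>- 2 \<mu> u - x\<close> are the increments that lead from gap \<open>0\<close> to the opposite gaps
  \<open>- x - \<mu> u\<close> and \<open>x + \<mu> u\<close>.
\<close>
lemma normal_density_reflect:
  assumes u: "0 < u"
  shows "exp (2 * \<mu> * (x + \<mu> * u)) * normal_density 0 (sqrt u) (- 2 * \<mu> * u - x) = normal_density 0 (sqrt u) x"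
proof -
  have "(\<mu> * 2 * u + x)\<^sup>2 / (2 * u) = (\<mu> * 2)\<^sup>2 * u / 2 + (\<mu> * 2) * x + x\<^sup>2 / (2 * u)"
    using u by (intro complete_square) simp
  moreover have "(- 2 * \<mu> * u - x)\<^sup>2 = (\<mu> * 2 * u + x)\<^sup>2"
    by (simp add: power2_eq_square algebra_simps)
  ultimately have "2 * \<mu> * (x + \<mu> * u) + - (- 2 * \<mu> * u - x)\<^sup>2 / (2 * u) = - x\<^sup>2 / (2 * u)"
    by (simp add: power_mult_distrib algebra_simps) (simp add: power2_eq_square)
  then have "exp (2 * \<mu> * (x + \<mu> * u)) * exp (- (- 2 * \<mu> * u - x)\<^sup>2 / (2 * u)) = exp (- x\<^sup>2 / (2 * u))"
    by (simp only: exp_add[symmetric])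
  then show ?thesis
    using u by (simp add: normal_density_def mult.left_commute)
qed

text \<open>
  A gap that starts at \<open>0\<close> and moves by \<open>- W - \<mu> u\<close> charges \<open>d\<close> and \<open>-d\<close> in exactly the ratio built into the
  reflection, so the two halves cancel.
\<close>
lemma integral_odd_reflection:
  assumes \<mu>: "0 \<le> \<mu>" and u: "0 < u"
    and f[measurable]: "f \<in> borel_measurable borel" and f_bounds: "\<And>x. 0 \<le> f x" "\<And>x. f x \<le> 1"
    and f_0: "\<And>x. x \<le> 0 \<Longrightarrow> f x = 0"
  shows "(LINT x|lborel. odd_reflection \<mu> f (- x - \<mu> * u) * normal_density 0 (sqrt u) x) = 0"
proof -
  let ?N = "normal_density 0 (sqrt u)"
  define k where "k x = f (x + \<mu> * u) * exp (2 * \<mu> * min (- x - \<mu> * u) 0) * ?N x" for x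
  have int1: "integrable lborel (\<lambda>x. f (- x - \<mu> * u) * ?N x)"
    using f_bounds u by (intro integrable_bounded_times_normal_density[where C=1]) auto
  have int2: "integrable lborel k"
    unfolding k_def
  proof (intro integrable_bounded_times_normal_density[where C=1])
    fix x
    have "exp (2 * \<mu> * min (- x - \<mu> * u) 0) \<le> 1" using \<mu> by (simp add: mult_nonneg_nonpos)
    then show "\<bar>f (x + \<mu> * u) * exp (2 * \<mu> * min (- x - \<mu> * u) 0)\<bar> \<le> 1"
      using f_bounds[of "x + \<mu> * u"] by (simp add: abs_mult mult_le_one)
  qed (use u in auto)
  have "(LINT x|lborel. k x) = (LINT x|lborel. k (- 2 * \<mu> * u + (- 1) * x))"
    using lborel_integral_real_affine[of "-1" k "- 2 * \<mu> * u"] by simp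
  also have "\<dots> = (LINT x|lborel. f (- x - \<mu> * u) * ?N x)"
  proof (intro Bochner_Integration.integral_cong refl)
    fix x
    show "k (- 2 * \<mu> * u + (- 1) * x) = f (- x - \<mu> * u) * ?N x"
    proof (cases "0 < - x - \<mu> * u")
      case True
      then have "min (- (- 2 * \<mu> * u - x) - \<mu> * u) 0 = x + \<mu> * u" by (simp add: algebra_simps)
      moreover have "- 2 * \<mu> * u + (- 1) * x = - 2 * \<mu> * u - x" by simp
      moreover have "- 2 * \<mu> * u - x + \<mu> * u = - x - \<mu> * u" by simp
      ultimately have "k (- 2 * \<mu> * u + (- 1) * x) =
          f (- x - \<mu> * u) * exp (2 * \<mu> * (x + \<mu> * u)) * ?N (- 2 * \<mu> * u - x)"
        by (simp only: k_def)
      then show ?thesis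
        by (simp only: mult.assoc[of "f (- x - \<mu> * u)"] normal_density_reflect[OF u])
    next
      case False
      then have "f (- x - \<mu> * u) = 0" by (intro f_0) simp
      moreover have "- 2 * \<mu> * u + (- 1) * x + \<mu> * u = - x - \<mu> * u" by simp
      ultimately show ?thesis by (simp only: k_def mult_zero_left)
    qed
  qed
  finally have k_eq: "(LINT x|lborel. k x) = (LINT x|lborel. f (- x - \<mu> * u) * ?N x)" .
  have "(LINT x|lborel. odd_reflection \<mu> f (- x - \<mu> * u) * ?N x) =
      (LINT x|lborel. f (- x - \<mu> * u) * ?N x - k x)"
    by (intro Bochner_Integration.integral_cong refl)
      (simp add: odd_reflection_def k_def left_diff_distrib add.commute)
  also have "\<dots> = 0"
    using Bochner_Integration.integral_diff[OF int1 int2] k_eq by simp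
  finally show ?thesis .
qed

context standard_brownian_motion
begin

lemma expectation_increment:
  fixes h :: "real \<Rightarrow> real"
  assumes h: "h \<in> borel_measurable borel" and st: "0 \<le> s" "s < t"
  shows "expectation (\<lambda>\<omega>. h (W t \<omega> - W s \<omega>)) = (LINT z|lborel. h z * normal_density 0 (sqrt (t - s)) z)"
proof -
  have "expectation (\<lambda>\<omega>. h (W t \<omega> - W s \<omega>)) = integral\<^sup>L (distr M borel (\<lambda>\<omega>. W t \<omega> - W s \<omega>)) h"
    using h st by (intro integral_distr[symmetric]) auto
  also have "\<dots> = (LINT z|lborel. h z * normal_density 0 (sqrt (t - s)) z)"
    unfolding normal_increment[OF st] using h by (subst integral_density) (auto simp: mult.commute)
  finally show ?thesis .
qed

lemma expectation_W:
  fixes h :: "real \<Rightarrow> real"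
  assumes h: "h \<in> borel_measurable borel" and t: "0 < t"
  shows "expectation (\<lambda>\<omega>. h (W t \<omega>)) = (LINT z|lborel. h z * normal_density 0 (sqrt t) z)"
proof -
  have "expectation (\<lambda>\<omega>. h (W t \<omega>)) = expectation (\<lambda>\<omega>. h (W t \<omega> - W 0 \<omega>))"
    by (intro Bochner_Integration.integral_cong) (auto simp: W_zero)
  then show ?thesis using expectation_increment[OF h order_refl t] by simp
qed

text \<open>
  The paths that hit and end on the safe side are traded for the paths that end beyond the barrier,
  for which the hit is automatic.  The ramps make the reflection identity applicable and converge to
  the indicator.
\<close>
lemma expectation_hit_gap_above:
  assumes \<mu>: "0 \<le> \<mu>" and b: "0 < b" and r: "0 < r" and c: "0 \<le> c"
  shows "expectation (\<lambda>\<omega>. of_bool (\<not> unhit \<mu> b r \<omega>) * of_bool (c < gap \<mu> b r \<omega>)) =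
    expectation (\<lambda>\<omega>. of_bool (gap \<mu> b r \<omega> < - c) * exp (2 * \<mu> * gap \<mu> b r \<omega>))"
proof -
  have [measurable]: "Measurable.pred M (unhit \<mu> b r)" "gap \<mu> b r \<in> borel_measurable M"
    using r by (simp_all add: measurable_unhit measurable_gap)
  let ?E = "\<lambda>\<omega>. exp (2 * \<mu> * min (gap \<mu> b r \<omega>) 0)"
  define G where "G n = odd_reflection \<mu> (ramp c n)" for n
  have G_meas[measurable]: "G n \<in> borel_measurable borel" for n
    unfolding G_def odd_reflection_def by measurable
  have zero: "expectation (\<lambda>\<omega>. of_bool (\<not> unhit \<mu> b r \<omega>) * G n (gap \<mu> b r \<omega>)) = 0" for n
  proof (rule hitting_reflection[OF G_meas _ _ b])
    show "\<bar>G n y\<bar> \<le> 1" for y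
      unfolding G_def using \<mu> ramp_bounds by (intro odd_reflection_bound)
    show "\<bar>G n x - G n y\<bar> \<le> (2 * real n + 2 * \<mu>) * \<bar>x - y\<bar>" for x y
      unfolding G_def using \<mu> ramp_bounds ramp_lipschitz by (intro odd_reflection_lipschitz)
    show "expectation (\<lambda>\<omega>. G n (- (W r \<omega> - W s \<omega>) - \<mu> * (r - s))) = 0" if s: "0 \<le> s" "s \<le> r" for s
    proof (cases "s = r")
      case True
      then show ?thesis using c by (simp add: G_def odd_reflection_def ramp_eq_0)
    next
      case False
      then have "s < r" using s by simp
      have "expectation (\<lambda>\<omega>. G n (- (W r \<omega> - W s \<omega>) - \<mu> * (r - s))) =
          (LINT x|lborel. G n (- x - \<mu> * (r - s)) * normal_density 0 (sqrt (r - s)) x)"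
        using expectation_increment[of "\<lambda>x. G n (- x - \<mu> * (r - s))", OF _ s(1) \<open>s < r\<close>] by simp
      also have "\<dots> = 0"
        unfolding G_def using \<mu> \<open>s < r\<close> ramp_bounds c
        by (intro integral_odd_reflection) (auto intro: ramp_eq_0)
      finally show ?thesis .
    qed
  qed (use r in simp)
  let ?lim = "\<lambda>\<omega>. of_bool (\<not> unhit \<mu> b r \<omega>) * (of_bool (c < gap \<mu> b r \<omega>) - of_bool (c < - gap \<mu> b r \<omega>) * ?E \<omega>)"
  have E_le: "?E \<omega> \<le> 1" for \<omega> using \<mu> by (simp add: mult_nonneg_nonpos)
  have "(\<lambda>n. expectation (\<lambda>\<omega>. of_bool (\<not> unhit \<mu> b r \<omega>) * G n (gap \<mu> b r \<omega>))) \<longlonglongrightarrow> expectation ?lim"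
  proof (rule integral_dominated_convergence[where w="\<lambda>_. 1"])
    show "AE \<omega> in M. (\<lambda>n. of_bool (\<not> unhit \<mu> b r \<omega>) * G n (gap \<mu> b r \<omega>)) \<longlonglongrightarrow> ?lim \<omega>"
      unfolding G_def odd_reflection_def by (intro AE_I2 tendsto_intros ramp_tendsto)
    show "AE \<omega> in M. norm (of_bool (\<not> unhit \<mu> b r \<omega>) * G n (gap \<mu> b r \<omega>)) \<le> 1" for n
      unfolding G_def using odd_reflection_bound[OF \<mu> ramp_bounds]
      by (intro AE_I2) (simp add: of_bool_def)
  qed simp_all
  then have lim_0: "expectation ?lim = 0"
    unfolding zero by (simp add: LIMSEQ_const_iff)
  have "of_bool (\<not> unhit \<mu> b r \<omega>) * of_bool (c < - gap \<mu> b r \<omega>) * ?E \<omega> =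
      of_bool (gap \<mu> b r \<omega> < - c) * exp (2 * \<mu> * gap \<mu> b r \<omega>)" if "\<omega> \<in> space M" for \<omega>
  proof -
    have "\<not> unhit \<mu> b r \<omega>" if "gap \<mu> b r \<omega> < - c"
      using that c r \<open>\<omega> \<in> space M\<close> by (auto simp: unhit_iff intro!: bexI[of _ r])
    then show ?thesis using c by (auto simp: of_bool_def min_def)
  qed
  then have "expectation (\<lambda>\<omega>. of_bool (gap \<mu> b r \<omega> < - c) * exp (2 * \<mu> * gap \<mu> b r \<omega>)) =
      expectation (\<lambda>\<omega>. of_bool (\<not> unhit \<mu> b r \<omega>) * of_bool (c < - gap \<mu> b r \<omega>) * ?E \<omega>)"
    by (intro Bochner_Integration.integral_cong) auto
  moreover have "expectation ?lim =
      expectation (\<lambda>\<omega>. of_bool (\<not> unhit \<mu> b r \<omega>) * of_bool (c < gap \<mu> b r \<omega>)) -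
      expectation (\<lambda>\<omega>. of_bool (\<not> unhit \<mu> b r \<omega>) * of_bool (c < - gap \<mu> b r \<omega>) * ?E \<omega>)"
    unfolding right_diff_distrib mult.assoc[symmetric] using E_le
    by (intro Bochner_Integration.integral_diff integrable_const_bound[where B=1]) (auto simp: of_bool_def)
  ultimately show ?thesis using lim_0 by simp
qed

end

section \<open>Joint law of survival and terminal value\<close>

lemma lborel_integral_reflect:
  fixes f :: "real \<Rightarrow> real"
  shows "(LINT x|lborel. f x) = (LINT x|lborel. f (m - x))"
  using lborel_integral_real_affine[of "-1" f m] by simp

text \<open>
  The factor \<open>exp (- 2 \<mu> d)\<close> from the reflection and the density of the mirrored endpoint combine to
  the bridge factor \<open>exp (- 2 b d / r)\<close>, in which the drift no longer appears.
\<close>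
lemma normal_density_shift_reflect:
  assumes r: "0 < r"
  shows "exp (- (2 * \<mu> * d)) * normal_density 0 (sqrt r) (b - \<mu> * r + d) =
    exp (- (2 * b / r) * d) * normal_density 0 (sqrt r) (b - \<mu> * r - d)"
proof -
  define m where "m = b - \<mu> * r"
  have "(m + d)\<^sup>2 / (2 * r) - (m - d)\<^sup>2 / (2 * r) = 2 * m * d / r"
    using r by (simp add: diff_divide_distrib[symmetric] power2_eq_square algebra_simps)
  also have "\<dots> = (2 * b / r) * d - 2 * \<mu> * d"
    using r by (simp add: m_def algebra_simps diff_divide_distrib)
  finally have exponent: "- (2 * \<mu> * d) + - (m + d)\<^sup>2 / (2 * r) = - (2 * b / r) * d + - (m - d)\<^sup>2 / (2 * r)"
    by simp
  have "exp (- (2 * \<mu> * d)) * exp (- (m + d)\<^sup>2 / (2 * r)) =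
      exp (- (2 * b / r) * d) * exp (- (m - d)\<^sup>2 / (2 * r))"
    unfolding exp_add[symmetric] exponent ..
  moreover have "E * (n * X) = F * (n * Y)" if "E * X = F * Y" for E F X Y n :: real
    using that by (simp add: mult.left_commute)
  ultimately show ?thesis
    using r unfolding normal_density_def m_def[symmetric] by simp
qed

context standard_brownian_motion
begin

lemma expectation_unhit_gap_above:
  assumes \<mu>: "0 \<le> \<mu>" and b: "0 < b" and r: "0 < r" and c: "0 \<le> c"
  shows "expectation (\<lambda>\<omega>. of_bool (unhit \<mu> b r \<omega>) * of_bool (c < gap \<mu> b r \<omega>)) =
    (LINT d|lborel. of_bool (c < d) * (1 - exp (- (2 * b / r) * d)) * normal_density 0 (sqrt r) (b - \<mu> * r - d))"
proof -
  have [measurable]: "Measurable.pred M (unhit \<mu> b r)" "gap \<mu> b r \<in> borel_measurable M"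
    using r by (simp_all add: measurable_unhit measurable_gap)
  let ?N = "normal_density 0 (sqrt r)"
  define m where "m = b - \<mu> * r"
  have gap_m: "gap \<mu> b r \<omega> = m - W r \<omega>" for \<omega> by (simp add: gap_def m_def)
  have above: "expectation (\<lambda>\<omega>. of_bool (c < gap \<mu> b r \<omega>)) = (LINT d|lborel. of_bool (c < d) * ?N (m - d))"
  proof -
    have "expectation (\<lambda>\<omega>. of_bool (c < gap \<mu> b r \<omega>)) = (LINT z|lborel. of_bool (c < m - z) * ?N z)"
      unfolding gap_m using expectation_W[of "\<lambda>z. of_bool (c < m - z)", OF _ r] by simp
    also have "\<dots> = (LINT d|lborel. of_bool (c < m - (m - d)) * ?N (m - d))"
      by (rule lborel_integral_reflect)
    finally show ?thesis by simp
  qed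
  have below: "expectation (\<lambda>\<omega>. of_bool (gap \<mu> b r \<omega> < - c) * exp (2 * \<mu> * gap \<mu> b r \<omega>)) =
      (LINT d|lborel. of_bool (c < d) * exp (- (2 * b / r) * d) * ?N (m - d))"
  proof -
    have "expectation (\<lambda>\<omega>. of_bool (gap \<mu> b r \<omega> < - c) * exp (2 * \<mu> * gap \<mu> b r \<omega>)) =
        (LINT z|lborel. of_bool (m - z < - c) * exp (2 * \<mu> * (m - z)) * ?N z)"
      unfolding gap_m using expectation_W[of "\<lambda>z. of_bool (m - z < - c) * exp (2 * \<mu> * (m - z))", OF _ r] by simp
    also have "\<dots> = (LINT d|lborel. of_bool (m - (m + 1 * d) < - c) * exp (2 * \<mu> * (m - (m + 1 * d))) * ?N (m + 1 * d))"
      by (subst lborel_integral_real_affine[where c = 1 and t = m]) simp_all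
    also have "\<dots> = (LINT d|lborel. of_bool (c < d) * exp (- (2 * b / r) * d) * ?N (m - d))"
    proof (intro Bochner_Integration.integral_cong refl)
      fix d
      have "exp (2 * \<mu> * (m - (m + 1 * d))) * ?N (m + 1 * d) = exp (- (2 * b / r) * d) * ?N (m - d)"
        using normal_density_shift_reflect[OF r, of \<mu> d b] by (simp add: m_def)
      then show "of_bool (m - (m + 1 * d) < - c) * exp (2 * \<mu> * (m - (m + 1 * d))) * ?N (m + 1 * d) =
          of_bool (c < d) * exp (- (2 * b / r) * d) * ?N (m - d)"
        by (simp only: mult.assoc) simp
    qed
    finally show ?thesis .
  qed
  have int_N: "integrable lborel (\<lambda>d. ?N (m - d))"
    using lborel_integrable_real_affine[of ?N "-1" m] r by simp
  have int1: "integrable lborel (\<lambda>d. of_bool (c < d) * ?N (m - d))"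
    by (rule Bochner_Integration.integrable_bound[OF int_N]) (auto simp: of_bool_def)
  have int2: "integrable lborel (\<lambda>d. of_bool (c < d) * exp (- (2 * b / r) * d) * ?N (m - d))"
  proof (rule Bochner_Integration.integrable_bound[OF int_N])
    have "exp (- (2 * b / r) * d) \<le> 1" if "c < d" for d
      using that b r c by (simp add: mult_nonneg_nonneg)
    then show "AE d in lborel. norm (of_bool (c < d) * exp (- (2 * b / r) * d) * ?N (m - d)) \<le> norm (?N (m - d))"
      by (intro AE_I2) (simp add: of_bool_def mult_left_le_one_le)
  qed measurable
  have "expectation (\<lambda>\<omega>. of_bool (unhit \<mu> b r \<omega>) * of_bool (c < gap \<mu> b r \<omega>)) =
      expectation (\<lambda>\<omega>. of_bool (c < gap \<mu> b r \<omega>) -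
        of_bool (\<not> unhit \<mu> b r \<omega>) * (of_bool (c < gap \<mu> b r \<omega>) :: real))"
    by (intro Bochner_Integration.integral_cong refl) (auto simp: of_bool_def)
  also have "\<dots> = expectation (\<lambda>\<omega>. of_bool (c < gap \<mu> b r \<omega>)) -
      expectation (\<lambda>\<omega>. of_bool (\<not> unhit \<mu> b r \<omega>) * of_bool (c < gap \<mu> b r \<omega>))"
    by (intro Bochner_Integration.integral_diff integrable_const_bound[where B=1]) (auto simp: of_bool_def)
  also have "\<dots> = (LINT d|lborel. of_bool (c < d) * ?N (m - d) - of_bool (c < d) * exp (- (2 * b / r) * d) * ?N (m - d))"
    unfolding expectation_hit_gap_above[OF \<mu> b r c] above below
    by (rule Bochner_Integration.integral_diff[OF int1 int2, symmetric])
  finally show ?thesis by (simp add: m_def algebra_simps)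
qed

text \<open>
  The previous formula determines the law of the gap on the surviving paths through its values on
  half-lines; both laws live on the positive half-line because survivors have a positive gap.
\<close>
lemma expectation_unhit_terminal:
  fixes h :: "real \<Rightarrow> real"
  assumes \<mu>: "0 \<le> \<mu>" and b: "0 \<le> b" and r: "0 < r" and h[measurable]: "h \<in> borel_measurable borel"
  shows "expectation (\<lambda>\<omega>. of_bool (unhit \<mu> b r \<omega>) * h (W r \<omega>)) =
    (LINT z|lborel. of_bool (z < b - \<mu> * r) * (1 - exp (- (2 * b / r) * (b - \<mu> * r - z))) * h z *
      normal_density 0 (sqrt r) z)"
proof (cases "b = 0")
  case True
  have "\<not> unhit \<mu> 0 r \<omega>" if "\<omega> \<in> space M" for \<omega>
    using unhit_antimono[OF order_refl, of r \<omega> \<mu> 0] unhit_0[OF that, of \<mu> 0] that r by auto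
  then have "expectation (\<lambda>\<omega>. of_bool (unhit \<mu> b r \<omega>) * h (W r \<omega>)) = expectation (\<lambda>_. 0)"
    using True by (intro Bochner_Integration.integral_cong) auto
  then show ?thesis using True by simp
next
  case False
  with b have b: "0 < b" by simp
  have [measurable]: "Measurable.pred M (unhit \<mu> b r)" "gap \<mu> b r \<in> borel_measurable M"
    using r by (simp_all add: measurable_unhit measurable_gap)
  define m where "m = b - \<mu> * r"
  have W_gap: "W r \<omega> = m - gap \<mu> b r \<omega>" for \<omega> by (simp add: gap_def m_def)
  define \<kappa> where "\<kappa> d = of_bool (0 < d) * (1 - exp (- (2 * b / r) * d)) * normal_density 0 (sqrt r) (m - d)" for d
  have [measurable]: "\<kappa> \<in> borel_measurable borel" unfolding \<kappa>_def by measurable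
  have \<kappa>_bounds: "0 \<le> \<kappa> d" "\<kappa> d \<le> normal_density 0 (sqrt r) (m - d)" for d
  proof -
    have "exp (- (2 * b / r) * d) \<le> 1" if "0 < d"
      using that b r by (simp add: mult_nonneg_nonneg)
    then show "0 \<le> \<kappa> d" "\<kappa> d \<le> normal_density 0 (sqrt r) (m - d)"
      by (auto simp: \<kappa>_def of_bool_def intro!: mult_left_le_one_le)
  qed
  have int_N: "integrable lborel (\<lambda>d. normal_density 0 (sqrt r) (m - d))"
    using lborel_integrable_real_affine[of "normal_density 0 (sqrt r)" "-1" m] r by simp
  have int_\<kappa>: "integrable lborel (\<lambda>d. of_bool (c < d) * \<kappa> d)" for c
    using \<kappa>_bounds by (intro Bochner_Integration.integrable_bound[OF int_N]) (auto simp: of_bool_def)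
  let ?\<nu>1 = "distr (density M (\<lambda>\<omega>. of_bool (unhit \<mu> b r \<omega>))) borel (gap \<mu> b r)"
  let ?\<nu>2 = "density lborel \<kappa>"
  have laws_eq: "?\<nu>1 = ?\<nu>2"
  proof (rule measure_eqI_lessThan)
    fix c :: real
    have restrict: "of_bool (unhit \<mu> b r \<omega>) * of_bool (c < gap \<mu> b r \<omega>) =
        of_bool (unhit \<mu> b r \<omega>) * (of_bool (max c 0 < gap \<mu> b r \<omega>) :: real)" if "\<omega> \<in> space M" for \<omega>
      using that r by (auto simp: unhit_iff)
    have 1: "emeasure ?\<nu>1 {c<..} = ennreal (expectation (\<lambda>\<omega>. of_bool (unhit \<mu> b r \<omega>) * of_bool (c < gap \<mu> b r \<omega>)))"
    proof -
      have "emeasure ?\<nu>1 {c<..} =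
          (\<integral>\<^sup>+\<omega>. of_bool (unhit \<mu> b r \<omega>) * indicator (gap \<mu> b r -` {c<..} \<inter> space M) \<omega> \<partial>M)"
        by (simp add: emeasure_distr emeasure_density)
      also have "\<dots> = (\<integral>\<^sup>+\<omega>. ennreal (of_bool (unhit \<mu> b r \<omega>) * of_bool (c < gap \<mu> b r \<omega>)) \<partial>M)"
        by (intro nn_integral_cong) (simp add: of_bool_def indicator_def)
      also have "\<dots> = ennreal (expectation (\<lambda>\<omega>. of_bool (unhit \<mu> b r \<omega>) * of_bool (c < gap \<mu> b r \<omega>)))"
        by (intro nn_integral_eq_integral integrable_const_bound[where B=1]) (auto simp: of_bool_def)
      finally show ?thesis .
    qed
    also have "\<dots> = ennreal (expectation (\<lambda>\<omega>. of_bool (unhit \<mu> b r \<omega>) * of_bool (max c 0 < gap \<mu> b r \<omega>)))"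
      using restrict by (intro arg_cong[where f=ennreal] Bochner_Integration.integral_cong) auto
    also have "\<dots> = ennreal (LINT d|lborel. of_bool (c < d) * \<kappa> d)"
      unfolding expectation_unhit_gap_above[OF \<mu> b r max.cobounded2]
      by (intro arg_cong[where f=ennreal] Bochner_Integration.integral_cong refl) (simp add: \<kappa>_def m_def)
    also have "\<dots> = (\<integral>\<^sup>+d. ennreal (of_bool (c < d) * \<kappa> d) \<partial>lborel)"
      using \<kappa>_bounds by (intro nn_integral_eq_integral[symmetric] int_\<kappa>) auto
    also have "\<dots> = (\<integral>\<^sup>+d. ennreal (\<kappa> d) * indicator {c<..} d \<partial>lborel)"
      by (intro nn_integral_cong) (simp add: of_bool_def indicator_def)
    also have "\<dots> = emeasure ?\<nu>2 {c<..}"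
      by (rule emeasure_density[symmetric]) auto
    finally show "emeasure ?\<nu>1 {c<..} = emeasure ?\<nu>2 {c<..}" .
    show "emeasure ?\<nu>1 {c<..} < \<infinity>" unfolding 1 by simp
  qed simp_all
  have "expectation (\<lambda>\<omega>. of_bool (unhit \<mu> b r \<omega>) * h (W r \<omega>)) =
      integral\<^sup>L (density M (\<lambda>\<omega>. ennreal (of_bool (unhit \<mu> b r \<omega>)))) (\<lambda>\<omega>. h (m - gap \<mu> b r \<omega>))"
    unfolding W_gap by (subst integral_density) auto
  also have "\<dots> = integral\<^sup>L ?\<nu>1 (\<lambda>d. h (m - d))"
    by (subst integral_distr) (auto simp: of_bool_def if_distrib cong: if_cong)
  also have "\<dots> = (LINT d|lborel. \<kappa> d * h (m - d))"
    unfolding laws_eq using \<kappa>_bounds by (subst integral_density) auto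
  also have "\<dots> = (LINT z|lborel. \<kappa> (m - z) * h (m - (m - z)))"
    by (rule lborel_integral_reflect)
  finally show ?thesis
    by (simp add: \<kappa>_def m_def mult_ac)
qed

end

section \<open>Survival probability given the value at the horizon\<close>

text \<open>
  Probability that a Brownian motion with drift \<open>\<mu>\<close> stays below \<open>a\<close> up to time \<open>s\<close>, for \<open>a \<ge> 0\<close>.
\<close>
definition survival :: "real \<Rightarrow> real \<Rightarrow> real \<Rightarrow> real"
  where "survival \<mu> s a =
    \<Phi> (a / sqrt s - \<mu> * sqrt s) - exp (2 * a * \<mu>) * \<Phi> (- a / sqrt s - \<mu> * sqrt s)"

text \<open>
  Probability of staying below \<open>b\<close> up to \<open>r < T\<close> given \<open>W T = x\<close>, for \<open>b \<ge> 0\<close>.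
\<close>
definition survival_given_later :: "real \<Rightarrow> real \<Rightarrow> real \<Rightarrow> real \<Rightarrow> real \<Rightarrow> real"
  where "survival_given_later \<mu> T r b x =
    (let a = b - x - \<mu> * T; v = 1 / r - 1 / T in
      \<Phi> (a / (T * sqrt v) + sqrt v * b) - exp (- 2 * a * b / T) * \<Phi> (a / (T * sqrt v) - sqrt v * b))"

text \<open>
  Probability of staying below \<open>b\<close> up to \<open>T\<close> given \<open>W T = x\<close>, for \<open>b \<ge> 0\<close>.  The maximum encodes the
  indicator of a positive final gap in a form that is visibly continuous in \<open>b\<close>.
\<close>
definition survival_given_end :: "real \<Rightarrow> real \<Rightarrow> real \<Rightarrow> real \<Rightarrow> real"
  where "survival_given_end \<mu> T b x = 1 - exp (- (2 * b / T) * max 0 (b - \<mu> * T - x))"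

lemma killed_normal_density_survival:
  assumes s: "0 < s" and a: "0 \<le> a"
  shows "(LINT z|lborel. of_bool (z < a - \<mu> * s) * (1 - exp (- (2 * a / s) * (a - \<mu> * s - z))) *
      normal_density 0 (sqrt s) z) = survival \<mu> s a"
    and "exp (2 * a * \<mu>) * \<Phi> (- a / sqrt s - \<mu> * sqrt s) \<le> 1"
proof -
  have \<sigma>: "0 < sqrt s" "(sqrt s)\<^sup>2 = s" and \<alpha>: "0 \<le> 2 * a / s" using s a by simp_all
  have s_sqrt: "s / sqrt s = sqrt s" using s by (simp add: real_div_sqrt)
  have \<mu>_sqrt: "\<mu> * s / sqrt s = \<mu> * sqrt s"
    unfolding times_divide_eq_right[symmetric] s_sqrt ..
  have arg1: "(a - \<mu> * s - 0) / sqrt s = a / sqrt s - \<mu> * sqrt s"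
    by (simp only: diff_divide_distrib \<mu>_sqrt)
  have "a - \<mu> * s - 0 - 2 * a / s * s = - a - \<mu> * s" using s by simp
  then have arg2: "(a - \<mu> * s - 0 - 2 * a / s * (sqrt s)\<^sup>2) / sqrt s = - a / sqrt s - \<mu> * sqrt s"
    by (simp only: \<sigma>(2) diff_divide_distrib \<mu>_sqrt)
  have expo: "- (2 * a / s) * (a - \<mu> * s - 0) + (2 * a / s)\<^sup>2 * (sqrt s)\<^sup>2 / 2 = 2 * a * \<mu>"
    unfolding \<sigma>(2) using s by (simp add: power2_eq_square field_simps)
  show "(LINT z|lborel. of_bool (z < a - \<mu> * s) * (1 - exp (- (2 * a / s) * (a - \<mu> * s - z))) *
      normal_density 0 (sqrt s) z) = survival \<mu> s a"
    using integral_killed_normal_density(1)[OF \<sigma>(1) \<alpha>, of "a - \<mu> * s" 0]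
    unfolding arg1 arg2 expo survival_def .
  show "exp (2 * a * \<mu>) * \<Phi> (- a / sqrt s - \<mu> * sqrt s) \<le> 1"
    using integral_killed_normal_density(2)[OF \<sigma>(1) \<alpha>, of "a - \<mu> * s" 0]
    unfolding arg1 arg2 expo .
qed

text \<open>
  The tilted integral, evaluated for the bridge variance \<open>r (T - r) / T = r\<^sup>2 v\<close>.
\<close>
lemma killed_normal_density_bridge:
  fixes b \<mu> r T x :: real
  defines "a \<equiv> b - x - \<mu> * T" and "v \<equiv> 1 / r - 1 / T"
  assumes r: "0 < r" "r < T" and b: "0 \<le> b"
  shows "(LINT z|lborel. of_bool (z < b - \<mu> * r) * (1 - exp (- (2 * b / r) * (b - \<mu> * r - z))) *
      normal_density (x * r / T) (sqrt (r * (T - r) / T)) z) = survival_given_later \<mu> T r b x"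
    and "exp (- 2 * a * b / T) * \<Phi> (a / (T * sqrt v) - sqrt v * b) \<le> 1"
proof -
  have v: "0 < v" using r by (simp add: v_def field_simps)
  have rvT: "r * v * T = T - r" using r by (simp add: v_def field_simps)
  have var: "r * (T - r) / T = r\<^sup>2 * v"
    using r by (simp add: rvT[symmetric] power2_eq_square)
  have sd: "sqrt (r * (T - r) / T) = r * sqrt v"
    unfolding var using r by (simp add: real_sqrt_mult)
  have \<sigma>: "0 < r * sqrt v" "(r * sqrt v)\<^sup>2 = r\<^sup>2 * v" and \<alpha>: "0 \<le> 2 * b / r"
    using r v b by (simp_all add: power_mult_distrib)
  have sqv: "sqrt v * sqrt v = v" using v by simp
  have num: "b - \<mu> * r - x * r / T = r * (a + T * v * b) / T"
  proof -
    have "r * (a + T * v * b) = r * a + (r * v * T) * b" by (simp add: algebra_simps)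
    also have "\<dots> = T * (b - \<mu> * r) - x * r" unfolding rvT by (simp add: a_def algebra_simps)
    finally show ?thesis using r by (simp add: field_simps)
  qed
  have arg1: "(b - \<mu> * r - x * r / T) / (r * sqrt v) = a / (T * sqrt v) + sqrt v * b"
  proof -
    have cancel: "(a + T * (w * w) * b) / (T * w) = a / (T * w) + w * b" if "0 < w" for w
      using r that by (simp add: add_divide_distrib)
    have "(b - \<mu> * r - x * r / T) / (r * sqrt v) = (a + T * (sqrt v * sqrt v) * b) / (T * sqrt v)"
      unfolding num sqv using r by simp
    also have "\<dots> = a / (T * sqrt v) + sqrt v * b"
      by (rule cancel) (use v in simp)
    finally show ?thesis .
  qed
  have arg2: "(b - \<mu> * r - x * r / T - 2 * b / r * (r * sqrt v)\<^sup>2) / (r * sqrt v) = a / (T * sqrt v) - sqrt v * b"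
  proof -
    have "2 * b / r * (r * w)\<^sup>2 / (r * w) = 2 * b * w" if "0 < w" for w
      using r that by (simp add: power2_eq_square)
    from this[of "sqrt v"] v have "2 * b / r * (r * sqrt v)\<^sup>2 / (r * sqrt v) = 2 * b * sqrt v"
      by (simp only: real_sqrt_gt_zero)
    then show ?thesis
      unfolding diff_divide_distrib[of "b - \<mu> * r - x * r / T"] arg1 by simp
  qed
  have expo: "- (2 * b / r) * (b - \<mu> * r - x * r / T) + (2 * b / r)\<^sup>2 * (r * sqrt v)\<^sup>2 / 2 = - 2 * a * b / T"
  proof -
    have "- (2 * b / r) * (b - \<mu> * r - x * r / T) = - 2 * b * (a + T * v * b) / T"
      unfolding num using r by simp
    moreover have "(2 * b / r)\<^sup>2 * (r * sqrt v)\<^sup>2 / 2 = 2 * b\<^sup>2 * v"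
      unfolding \<sigma>(2) using r by (simp add: power_divide power_mult_distrib)
    moreover have "- 2 * b * (a + T * v * b) / T = - 2 * a * b / T - 2 * b\<^sup>2 * v"
      using r by (simp add: field_simps power2_eq_square)
    ultimately show ?thesis by simp
  qed
  have "survival_given_later \<mu> T r b x = \<Phi> (a / (T * sqrt v) + sqrt v * b) -
      exp (- 2 * a * b / T) * \<Phi> (a / (T * sqrt v) - sqrt v * b)"
    by (simp only: survival_given_later_def Let_def a_def v_def)
  then show "(LINT z|lborel. of_bool (z < b - \<mu> * r) * (1 - exp (- (2 * b / r) * (b - \<mu> * r - z))) *
      normal_density (x * r / T) (sqrt (r * (T - r) / T)) z) = survival_given_later \<mu> T r b x"
    using integral_killed_normal_density(1)[OF \<sigma>(1) \<alpha>, of "b - \<mu> * r" "x * r / T"]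
    unfolding arg1 arg2 expo sd by (rule trans[OF _ sym, rotated])
  show "exp (- 2 * a * b / T) * \<Phi> (a / (T * sqrt v) - sqrt v * b) \<le> 1"
    using integral_killed_normal_density(2)[OF \<sigma>(1) \<alpha>, of "b - \<mu> * r" "x * r / T"]
    unfolding arg1 arg2 expo .
qed

lemma diff_unit_bound:
  fixes p q :: real
  assumes "0 \<le> p" "p \<le> 1" "0 \<le> q" "q \<le> 1"
  shows "\<bar>p - q\<bar> \<le> 1"
  using assms by linarith

lemma survival_bound:
  assumes "0 < s" "0 \<le> a"
  shows "\<bar>survival \<mu> s a\<bar> \<le> 1"
  unfolding survival_def using killed_normal_density_survival(2)[OF assms]
  by (intro diff_unit_bound std_normal_cdf_nonneg std_normal_cdf_le_1 mult_nonneg_nonneg) auto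

lemma survival_given_later_bound:
  assumes "0 < r" "r < T" "0 \<le> b"
  shows "\<bar>survival_given_later \<mu> T r b x\<bar> \<le> 1"
  unfolding survival_given_later_def Let_def using killed_normal_density_bridge(2)[OF assms]
  by (intro diff_unit_bound std_normal_cdf_nonneg std_normal_cdf_le_1 mult_nonneg_nonneg) auto

lemma survival_given_end_bounds:
  assumes "0 < T" "0 \<le> b"
  shows "0 \<le> survival_given_end \<mu> T b x" "survival_given_end \<mu> T b x \<le> 1"
  using assms by (simp_all add: survival_given_end_def)

lemma borel_measurable_survival [measurable]: "survival \<mu> s \<in> borel_measurable borel"
  unfolding survival_def by measurable

context standard_brownian_motion
begin

lemma expectation_unhit:
  assumes "0 \<le> \<mu>" "0 \<le> b" "0 < r"
  shows "expectation (\<lambda>\<omega>. of_bool (unhit \<mu> b r \<omega>)) = survival \<mu> r b"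
  using expectation_unhit_terminal[OF assms, of "\<lambda>_. 1"] killed_normal_density_survival(1)[OF assms(3,2)]
  by simp

lemma unhit_at_end:
  assumes \<mu>: "0 \<le> \<mu>" and T: "0 < T" and b: "0 \<le> b" and h[measurable]: "h \<in> borel_measurable borel"
  shows "expectation (\<lambda>\<omega>. of_bool (unhit \<mu> b T \<omega>) * h (W T \<omega>)) =
    (LINT x|lborel. survival_given_end \<mu> T b x * h x * normal_density 0 (sqrt T) x)"
  unfolding expectation_unhit_terminal[OF \<mu> b T h]
proof (intro Bochner_Integration.integral_cong refl)
  fix x
  have "of_bool (x < b - \<mu> * T) * (1 - exp (- (2 * b / T) * (b - \<mu> * T - x))) = survival_given_end \<mu> T b x"
    by (cases "x < b - \<mu> * T") (simp_all add: survival_given_end_def)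
  then show "of_bool (x < b - \<mu> * T) * (1 - exp (- (2 * b / T) * (b - \<mu> * T - x))) * h x *
      normal_density 0 (sqrt T) x = survival_given_end \<mu> T b x * h x * normal_density 0 (sqrt T) x"
    by (simp only:)
qed

text \<open>
  Survival beyond \<open>T\<close> is survival up to \<open>T\<close> together with survival of the restarted motion below the
  current gap, and the restarted motion is independent of the past.
\<close>
lemma unhit_after_end:
  assumes \<mu>: "0 \<le> \<mu>" and T: "0 < T" "T < r" and b: "0 \<le> b" and A[measurable]: "A \<in> sets borel"
  shows "expectation (\<lambda>\<omega>. of_bool (unhit \<mu> b r \<omega>) * of_bool (W T \<omega> \<in> A)) =
    (LINT x|lborel. survival_given_end \<mu> T b x * survival \<mu> (r - T) (b - \<mu> * T - x) * of_bool (x \<in> A) *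
      normal_density 0 (sqrt T) x)"
proof -
  interpret R: standard_brownian_motion M "\<lambda>u \<omega>. W (T + u) \<omega> - W T \<omega>"
    using T by (intro restart_standard_brownian_motion) simp
  define F where "F w w' = of_bool (stays_below \<mu> T b w) * of_bool (w T \<in> A) *
    (of_bool (stays_below \<mu> (r - T) (b - \<mu> * T - w T) w') :: real)" for w w' :: "real \<Rightarrow> real"
  have [measurable]: "(\<lambda>w. w T) \<in> borel_measurable (\<Pi>\<^sub>M u\<in>{0..T}. borel)"
    using T by (auto intro!: measurable_component_singleton)
  have [measurable]: "Measurable.pred ((\<Pi>\<^sub>M u\<in>{0..T}. borel) \<Otimes>\<^sub>M (\<Pi>\<^sub>M u\<in>{0..}. borel)) (\<lambda>x. stays_below \<mu> T b (fst x))"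
    using T by (intro measurable_stays_below[where I="{0..T}"]) auto
  have [measurable]: "Measurable.pred ((\<Pi>\<^sub>M u\<in>{0..T}. borel) \<Otimes>\<^sub>M (\<Pi>\<^sub>M u\<in>{0..}. borel))
      (\<lambda>x. stays_below \<mu> (r - T) (b - \<mu> * T - fst x T) (snd x))"
    using T by (intro measurable_stays_below[where I="{0..}"]) auto
  have F_meas: "(\<lambda>(w, w'). F w w') \<in> borel_measurable ((\<Pi>\<^sub>M u\<in>{0..T}. borel) \<Otimes>\<^sub>M (\<Pi>\<^sub>M u\<in>{0..}. borel))"
    unfolding F_def split_beta by measurable
  have F_bound: "\<bar>F w w'\<bar> \<le> 1" for w w' by (simp add: F_def of_bool_def)
  have future_unhit: "stays_below \<mu> (r - T) a (future T \<omega>) = R.unhit \<mu> a (r - T) \<omega>" for a \<omega>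
    unfolding R.unhit_def using T by (intro stays_below_cong) (auto simp: future_def)
  have F_eq: "F (past T \<omega>) (future T \<omega>') =
      of_bool (unhit \<mu> b T \<omega>) * of_bool (W T \<omega> \<in> A) * of_bool (R.unhit \<mu> (gap \<mu> b T \<omega>) (r - T) \<omega>')" for \<omega> \<omega>'
    using T unfolding F_def
    by (simp add: stays_below_past future_unhit) (simp add: past_def gap_def)
  have split_unhit: "unhit \<mu> b r \<omega> \<longleftrightarrow> unhit \<mu> b T \<omega> \<and> R.unhit \<mu> (gap \<mu> b T \<omega>) (r - T) \<omega>"
    if \<omega>: "\<omega> \<in> space M" for \<omega>
  proof -
    have "R.gap \<mu> (gap \<mu> b T \<omega>) u \<omega> = gap \<mu> b (T + u) \<omega>" for u
      unfolding R.gap_def gap_def by (simp add: algebra_simps)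
    then have "R.unhit \<mu> (gap \<mu> b T \<omega>) (r - T) \<omega> \<longleftrightarrow> (\<forall>u\<in>{0..r - T}. 0 < gap \<mu> b (T + u) \<omega>)"
      using T \<omega> by (subst R.unhit_iff) simp_all
    also have "\<dots> \<longleftrightarrow> (\<forall>u\<in>{T..r}. 0 < gap \<mu> b u \<omega>)"
    proof
      assume *: "\<forall>u\<in>{0..r - T}. 0 < gap \<mu> b (T + u) \<omega>"
      show "\<forall>u\<in>{T..r}. 0 < gap \<mu> b u \<omega>"
      proof
        fix u assume "u \<in> {T..r}"
        then show "0 < gap \<mu> b u \<omega>" using *[rule_format, of "u - T"] by simp
      qed
    qed auto
    finally have R_iff: "R.unhit \<mu> (gap \<mu> b T \<omega>) (r - T) \<omega> \<longleftrightarrow> (\<forall>u\<in>{T..r}. 0 < gap \<mu> b u \<omega>)" .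
    have "{0..r} = {0..T} \<union> {T..r}" using T by auto
    then show ?thesis
      using T \<omega> by (simp add: R_iff unhit_iff ball_Un)
  qed
  have "expectation (\<lambda>\<omega>. of_bool (unhit \<mu> b r \<omega>) * of_bool (W T \<omega> \<in> A)) =
      expectation (\<lambda>\<omega>. F (past T \<omega>) (future T \<omega>))"
    using split_unhit by (intro Bochner_Integration.integral_cong refl) (auto simp: F_eq)
  also have "\<dots> = expectation (\<lambda>\<omega>. expectation (\<lambda>\<omega>'. F (past T \<omega>) (future T \<omega>')))"
    using T by (intro expectation_past_future(2)[OF _ F_meas F_bound]) simp
  also have "\<dots> = expectation (\<lambda>\<omega>. of_bool (unhit \<mu> b T \<omega>) *
      (survival \<mu> (r - T) (b - \<mu> * T - W T \<omega>) * of_bool (W T \<omega> \<in> A)))"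
  proof (intro Bochner_Integration.integral_cong refl)
    fix \<omega> assume \<omega>: "\<omega> \<in> space M"
    show "expectation (\<lambda>\<omega>'. F (past T \<omega>) (future T \<omega>')) = of_bool (unhit \<mu> b T \<omega>) *
      (survival \<mu> (r - T) (b - \<mu> * T - W T \<omega>) * of_bool (W T \<omega> \<in> A))"
    proof (cases "unhit \<mu> b T \<omega>")
      case True
      then have "0 < gap \<mu> b T \<omega>" using T \<omega> by (simp add: unhit_iff)
      then have "expectation (\<lambda>\<omega>'. of_bool (R.unhit \<mu> (gap \<mu> b T \<omega>) (r - T) \<omega>')) = survival \<mu> (r - T) (gap \<mu> b T \<omega>)"
        using \<mu> T by (intro R.expectation_unhit) auto
      then show ?thesis using True by (simp add: F_eq gap_def)
    qed (simp add: F_eq)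
  qed
  also have "\<dots> = (LINT x|lborel. survival_given_end \<mu> T b x *
      (survival \<mu> (r - T) (b - \<mu> * T - x) * of_bool (x \<in> A)) * normal_density 0 (sqrt T) x)"
    by (rule unhit_at_end[OF \<mu> T(1) b]) measurable
  finally show ?thesis by (simp only: mult.assoc)
qed

text \<open>
  The increment from \<open>r\<close> to \<open>T\<close> is independent of the past of \<open>r\<close>.  Integrating it against the joint law at time
  \<open>r\<close> and exchanging the order of integration leaves, for each endpoint \<open>x\<close>, an integral against the
  bridge density.
\<close>
lemma unhit_before_end:
  assumes \<mu>: "0 \<le> \<mu>" and r: "0 < r" "r < T" and b: "0 \<le> b" and A[measurable]: "A \<in> sets borel"
  shows "expectation (\<lambda>\<omega>. of_bool (unhit \<mu> b r \<omega>) * of_bool (W T \<omega> \<in> A)) =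
    (LINT x|lborel. survival_given_later \<mu> T r b x * of_bool (x \<in> A) * normal_density 0 (sqrt T) x)"
proof -
  define F where "F w w' = of_bool (stays_below \<mu> r b w) * (of_bool (w r + w' (T - r) \<in> A) :: real)"
    for w w' :: "real \<Rightarrow> real"
  have [measurable]: "(\<lambda>w. w r) \<in> borel_measurable (\<Pi>\<^sub>M u\<in>{0..r}. borel)"
    "(\<lambda>w. w (T - r)) \<in> borel_measurable (\<Pi>\<^sub>M u\<in>{0..}. borel)"
    using r by (auto intro!: measurable_component_singleton)
  have [measurable]: "Measurable.pred ((\<Pi>\<^sub>M u\<in>{0..r}. borel) \<Otimes>\<^sub>M (\<Pi>\<^sub>M u\<in>{0..}. borel)) (\<lambda>x. stays_below \<mu> r b (fst x))"
    using r by (intro measurable_stays_below[where I="{0..r}"]) auto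
  have F_meas: "(\<lambda>(w, w'). F w w') \<in> borel_measurable ((\<Pi>\<^sub>M u\<in>{0..r}. borel) \<Otimes>\<^sub>M (\<Pi>\<^sub>M u\<in>{0..}. borel))"
    unfolding F_def split_beta by measurable
  have F_bound: "\<bar>F w w'\<bar> \<le> 1" for w w' by (simp add: F_def of_bool_def)
  have F_eq: "F (past r \<omega>) (future r \<omega>') =
      of_bool (unhit \<mu> b r \<omega>) * of_bool (W r \<omega> + (W T \<omega>' - W r \<omega>') \<in> A)" for \<omega> \<omega>'
    using r unfolding F_def by (simp add: stays_below_past) (simp add: past_def future_def)
  let ?N = "\<lambda>t. normal_density 0 (sqrt t)"
  define k where "k z = of_bool (z < b - \<mu> * r) * (1 - exp (- (2 * b / r) * (b - \<mu> * r - z)))" for z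
  have [measurable]: "k \<in> borel_measurable borel" unfolding k_def by measurable
  have k_bounds: "0 \<le> k z" "k z \<le> 1" for z
    using b r by (auto simp: k_def of_bool_def)
  define B where "B x z = normal_density (x * r / T) (sqrt (r * (T - r) / T)) z" for x z
  have B_meas[measurable]: "(\<lambda>(x, z). B x z) \<in> borel_measurable (lborel \<Otimes>\<^sub>M lborel)"
    unfolding B_def normal_density_def by measurable
  define h where "h z = (LINT x|lborel. of_bool (x \<in> A) * ?N (T - r) (x - z))" for z
  have h_meas[measurable]: "h \<in> borel_measurable borel"
    unfolding h_def by measurable
  have "expectation (\<lambda>\<omega>. of_bool (unhit \<mu> b r \<omega>) * of_bool (W T \<omega> \<in> A)) =
      expectation (\<lambda>\<omega>. F (past r \<omega>) (future r \<omega>))"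
    by (simp add: F_eq)
  also have "\<dots> = expectation (\<lambda>\<omega>. expectation (\<lambda>\<omega>'. F (past r \<omega>) (future r \<omega>')))"
    using r by (intro expectation_past_future(2)[OF _ F_meas F_bound]) simp
  also have "\<dots> = expectation (\<lambda>\<omega>. of_bool (unhit \<mu> b r \<omega>) * h (W r \<omega>))"
  proof -
    have "expectation (\<lambda>\<omega>'. of_bool (z + (W T \<omega>' - W r \<omega>') \<in> A)) = h z" for z
    proof -
      have "expectation (\<lambda>\<omega>'. of_bool (z + (W T \<omega>' - W r \<omega>') \<in> A)) =
          (LINT y|lborel. of_bool (z + y \<in> A) * ?N (T - r) y)"
        using expectation_increment[of "\<lambda>y. of_bool (z + y \<in> A)" r T] r by simp
      also have "\<dots> = h z"
        unfolding h_def by (subst (2) lborel_integral_real_affine[where c=1 and t=z]) simp_all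
      finally show ?thesis .
    qed
    then show ?thesis by (simp add: F_eq)
  qed
  also have "\<dots> = (LINT z|lborel. k z * h z * ?N r z)"
    unfolding expectation_unhit_terminal[OF \<mu> b r(1) h_meas] k_def ..
  also have "\<dots> = (LINT z|lborel. LINT x|lborel. of_bool (x \<in> A) * ?N T x * (k z * B x z))"
  proof (intro Bochner_Integration.integral_cong refl)
    fix z
    have "k z * h z * ?N r z = (LINT x|lborel. (k z * ?N r z) * (of_bool (x \<in> A) * ?N (T - r) (x - z)))"
      unfolding h_def by simp
    also have "\<dots> = (LINT x|lborel. of_bool (x \<in> A) * ?N T x * (k z * B x z))"
    proof (intro Bochner_Integration.integral_cong refl)
      fix x
      have "(k z * ?N r z) * (of_bool (x \<in> A) * ?N (T - r) (x - z)) =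
          k z * of_bool (x \<in> A) * (?N r z * ?N (T - r) (x - z))" by simp
      also have "\<dots> = of_bool (x \<in> A) * ?N T x * (k z * B x z)"
        unfolding normal_density_bridge[OF r] B_def by simp
      finally show "(k z * ?N r z) * (of_bool (x \<in> A) * ?N (T - r) (x - z)) = \<dots>" .
    qed
    finally show "k z * h z * ?N r z = (LINT x|lborel. of_bool (x \<in> A) * ?N T x * (k z * B x z))" .
  qed
  also have "\<dots> = (LINT x|lborel. LINT z|lborel. of_bool (x \<in> A) * ?N T x * (k z * B x z))"
  proof (rule lborel_pair.Fubini_integral)
    have \<sigma>: "0 < sqrt (r * (T - r) / T)" using r by simp
    have int_kB: "integrable lborel (\<lambda>z. k z * B x z)" for x
      unfolding B_def using \<sigma> k_bounds by (intro integrable_bounded_times_normal_density[where C=1]) auto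
    have kB_le: "0 \<le> (LINT z|lborel. k z * B x z)" "(LINT z|lborel. k z * B x z) \<le> 1" for x
    proof -
      show "0 \<le> (LINT z|lborel. k z * B x z)"
        using k_bounds by (intro Bochner_Integration.integral_nonneg) (simp add: B_def)
      have "(LINT z|lborel. k z * B x z) \<le> (LINT z|lborel. B x z)"
        using \<sigma> k_bounds by (intro integral_mono int_kB) (auto simp: B_def intro: mult_left_le_one_le)
      then show "(LINT z|lborel. k z * B x z) \<le> 1" using \<sigma> by (simp add: B_def)
    qed
    show "integrable (lborel \<Otimes>\<^sub>M lborel) (\<lambda>(x, z). of_bool (x \<in> A) * ?N T x * (k z * B x z))"
    proof (rule lborel_pair.Fubini_integrable)
      have "(LINT z|lborel. norm (of_bool (x \<in> A) * ?N T x * (k z * B x z))) =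
          of_bool (x \<in> A) * (LINT z|lborel. k z * B x z) * ?N T x" for x
        using k_bounds by (simp add: abs_mult B_def)
      moreover have "integrable lborel (\<lambda>x. of_bool (x \<in> A) * (LINT z|lborel. k z * B x z) * ?N T x)"
        using r kB_le by (intro integrable_bounded_times_normal_density[where C=1]) (auto simp: of_bool_def)
      ultimately show "integrable lborel (\<lambda>x. LINT z|lborel. norm (case (x, z) of (x, z) \<Rightarrow> of_bool (x \<in> A) * ?N T x * (k z * B x z)))"
        by simp
      show "AE x in lborel. integrable lborel (\<lambda>z. case (x, z) of (x, z) \<Rightarrow> of_bool (x \<in> A) * ?N T x * (k z * B x z))"
        using int_kB by (intro AE_I2) simp
    qed measurable
  qed
  also have "\<dots> = (LINT x|lborel. of_bool (x \<in> A) * ?N T x * survival_given_later \<mu> T r b x)"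
    using killed_normal_density_bridge(1)[OF r b, of \<mu>]
    by (simp add: k_def B_def)
  finally show ?thesis by (simp add: mult_ac)
qed

end

section \<open>Barriers depending on the value at the horizon\<close>

lemma sum_over_values:
  fixes \<phi> :: "'b \<Rightarrow> real"
  assumes "finite Y" "f x \<in> Y"
  shows "(\<Sum>y\<in>Y. \<phi> y * of_bool (x \<in> f -` {y})) = \<phi> (f x)"
proof -
  have "(\<Sum>y\<in>Y. \<phi> y * of_bool (x \<in> f -` {y})) = (\<Sum>y\<in>{f x}. \<phi> y * of_bool (x \<in> f -` {y}))"
    using assms by (intro sum.mono_neutral_right) auto
  then show ?thesis by simp
qed

text \<open>
  The set of hitting times is closed and does not accumulate at \<open>0\<close>, where the path is strictly off
  the barrier; so the infimum, when finite, is itself a hitting time.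
\<close>
lemma Inf_hitting_times_le_iff:
  fixes D :: "real \<Rightarrow> real"
  assumes D: "continuous_on {0..} D" "0 < D 0" and r: "0 \<le> r"
  shows "Inf (ereal ` {t. 0 < t \<and> D t \<le> 0}) \<le> ereal r \<longleftrightarrow> (\<exists>t\<in>{0..r}. D t \<le> 0)"
proof
  assume "\<exists>t\<in>{0..r}. D t \<le> 0"
  then obtain t where t: "0 \<le> t" "t \<le> r" "D t \<le> 0" by auto
  with D have "0 < t" by (cases "t = 0") auto
  then have "Inf (ereal ` {t. 0 < t \<and> D t \<le> 0}) \<le> ereal t"
    using t by (intro Inf_lower) auto
  also have "\<dots> \<le> ereal r" using t by simp
  finally show "Inf (ereal ` {t. 0 < t \<and> D t \<le> 0}) \<le> ereal r" .
next
  assume le: "Inf (ereal ` {t. 0 < t \<and> D t \<le> 0}) \<le> ereal r"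
  show "\<exists>t\<in>{0..r}. D t \<le> 0"
  proof (rule ccontr)
    assume "\<not> (\<exists>t\<in>{0..r}. D t \<le> 0)"
    then have pos: "\<And>t. 0 \<le> t \<Longrightarrow> t \<le> r \<Longrightarrow> 0 < D t" by (auto simp: not_le)
    obtain \<delta> where \<delta>: "0 < \<delta>" "\<And>t. 0 \<le> t \<Longrightarrow> dist t r < \<delta> \<Longrightarrow> dist (D t) (D r) < D r"
      using D(1)[unfolded continuous_on_iff] r pos[OF r order_refl] by (metis atLeast_iff)
    have "ereal (r + \<delta>) \<le> Inf (ereal ` {t. 0 < t \<and> D t \<le> 0})"
    proof (rule Inf_greatest)
      fix y assume "y \<in> ereal ` {t. 0 < t \<and> D t \<le> 0}"
      then obtain t where t: "y = ereal t" "0 < t" "D t \<le> 0" by auto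
      have "r < t" using pos[of t] t by linarith
      moreover have "\<not> dist t r < \<delta>"
        using \<delta>(2)[of t] t by (auto simp: dist_real_def)
      ultimately show "ereal (r + \<delta>) \<le> y" using t by (simp add: dist_real_def)
    qed
    with le have "ereal (r + \<delta>) \<le> ereal r" by (rule order_trans[rotated])
    with \<delta>(1) show False by simp
  qed
qed

lemma continuous_on_survival_given_later:
  assumes "0 < r" "r < T"
  shows "continuous_on S (\<lambda>b. survival_given_later \<mu> T r b x)"
proof -
  have "T * sqrt (1 / r - 1 / T) \<noteq> 0" using assms by (simp add: field_simps)
  then show ?thesis
    using assms unfolding survival_given_later_def Let_def
    by (intro continuous_intros ballI) auto
qed

lemma continuous_on_survival:
  assumes "0 < s" "continuous_on S f"
  shows "continuous_on S (\<lambda>b. survival \<mu> s (f b))"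
proof -
  have "sqrt s \<noteq> 0" using assms by simp
  then show ?thesis
    using assms(2) unfolding survival_def by (intro continuous_intros ballI) auto
qed

lemma continuous_on_survival_given_end:
  assumes "0 < T"
  shows "continuous_on S (\<lambda>b. survival_given_end \<mu> T b x)"
  using assms unfolding survival_given_end_def by (intro continuous_intros ballI) auto

lemma borel_measurable_survival_given_end [measurable]:
  "survival_given_end \<mu> T b \<in> borel_measurable borel"
  unfolding survival_given_end_def by measurable

lemma borel_measurable_survival_given_later [measurable]:
  "survival_given_later \<mu> T r b \<in> borel_measurable borel"
  unfolding survival_given_later_def Let_def by measurable

context standard_brownian_motion
begin

lemma measurable_unhit_random_barrier [measurable]:
  assumes r: "0 \<le> r" and f[measurable]: "f \<in> borel_measurable M"
  shows "Measurable.pred M (\<lambda>\<omega>. unhit \<mu> (f \<omega>) r \<omega>)"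
proof -
  have "Measurable.pred M (\<lambda>\<omega>. stays_below \<mu> r (f \<omega>) (past r \<omega>))"
    using r by (intro measurable_stays_below[where I = "{0..r}"]) auto
  then show ?thesis using r by (simp add: stays_below_past)
qed

text \<open>
  A surviving path has a positive minimal gap and already survives a slightly lower barrier; a path
  that hits also hits every lower barrier.
\<close>
lemma unhit_tendsto_barrier:
  assumes r: "0 \<le> r" and \<omega>: "\<omega> \<in> space M"
    and lim: "(\<lambda>n. c n) \<longlonglongrightarrow> b" and le: "\<And>n. c n \<le> b"
  shows "(\<lambda>n. of_bool (unhit \<mu> (c n) r \<omega>) :: real) \<longlonglongrightarrow> of_bool (unhit \<mu> b r \<omega>)"
proof (cases "unhit \<mu> b r \<omega>")
  case True
  obtain m where m: "m \<in> {0..r}" "\<And>u. u \<in> {0..r} \<Longrightarrow> gap \<mu> b m \<omega> \<le> gap \<mu> b u \<omega>"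
    using continuous_attains_inf[of "{0..r}" "\<lambda>u. gap \<mu> b u \<omega>"] continuous_on_gap[OF \<omega>, of r \<mu> b] r
    by auto
  then have "b - gap \<mu> b m \<omega> < b" using True r \<omega> by (simp add: unhit_iff)
  then have "eventually (\<lambda>n. b - gap \<mu> b m \<omega> < c n) sequentially"
    by (rule order_tendstoD(1)[OF lim])
  then have "eventually (\<lambda>n. of_bool (unhit \<mu> (c n) r \<omega>) = (1 :: real)) sequentially"
  proof eventually_elim
    case (elim n)
    have "0 < gap \<mu> (c n) u \<omega>" if "u \<in> {0..r}" for u
      using elim m(2)[OF that] by (simp add: gap_def)
    then show ?case using r \<omega> by (simp add: unhit_iff)
  qed
  then show ?thesis using True by (simp add: tendsto_eventually)
next
  case False
  have "\<not> unhit \<mu> (c n) r \<omega>" for n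
  proof -
    obtain u where "u \<in> {0..r}" "gap \<mu> b u \<omega> \<le> 0"
      using False r \<omega> by (auto simp: unhit_iff not_less)
    then show ?thesis using le[of n] r \<omega> by (auto simp: unhit_iff gap_def not_less intro!: bexI[of _ u])
  qed
  then show ?thesis using False by simp
qed

text \<open>
  For a barrier with finitely many values the claim is a finite sum over the events that \<open>W T\<close> lies in
  a level set.  A general barrier is the increasing limit of such barriers, and both sides pass to
  the limit by dominated convergence.
\<close>
lemma expectation_unhit_random_barrier:
  fixes K :: "real \<Rightarrow> real \<Rightarrow> real"
  assumes r: "0 \<le> r" and T: "0 < T"
    and \<beta>[measurable]: "\<beta> \<in> borel_measurable borel" and \<beta>_nonneg: "\<And>x. 0 \<le> \<beta> x"
    and K_meas: "\<And>b. 0 \<le> b \<Longrightarrow> K b \<in> borel_measurable borel"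
    and K_bound: "\<And>b x. 0 \<le> b \<Longrightarrow> \<bar>K b x\<bar> \<le> C"
    and K_cont: "\<And>x. continuous_on {0..} (\<lambda>b. K b x)"
    and fixed_barrier: "\<And>b A. 0 \<le> b \<Longrightarrow> A \<in> sets borel \<Longrightarrow>
      expectation (\<lambda>\<omega>. of_bool (unhit \<mu> b r \<omega>) * of_bool (W T \<omega> \<in> A)) =
      (LINT x|lborel. K b x * of_bool (x \<in> A) * normal_density 0 (sqrt T) x)"
  shows "expectation (\<lambda>\<omega>. of_bool (unhit \<mu> (\<beta> (W T \<omega>)) r \<omega>)) =
    (LINT x|lborel. K (\<beta> x) x * normal_density 0 (sqrt T) x)"
proof -
  let ?N = "normal_density 0 (sqrt T)"
  have C: "0 \<le> C" using K_bound[of 0 0] by linarith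
  have [measurable]: "W T \<in> borel_measurable M" using T by simp
  obtain f where f: "incseq f" "\<And>n. simple_function borel (f n)"
      "\<And>x. bdd_above (range (\<lambda>n. f n x))" "\<And>n x. 0 \<le> f n x" "\<beta> = (SUP n. f n)"
    using borel_measurable_implies_simple_function_sequence_real[OF \<beta> \<beta>_nonneg] by metis
  have f_meas[measurable]: "f n \<in> borel_measurable borel" for n
    using f(2) by (rule borel_measurable_simple_function)
  have f_fin: "finite (range (f n))" for n
    using simple_functionD(1)[OF f(2)[of n]] by simp
  have f_vimage[measurable]: "f n -` {y} \<in> sets borel" for n y
    using measurable_sets[OF f_meas, of "{y}" n] by simp
  have \<beta>_eq: "\<beta> x = (SUP n. f n x)" for x
    by (simp add: f(5) image_image)
  have f_lim: "(\<lambda>n. f n x) \<longlonglongrightarrow> \<beta> x" for x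
    unfolding \<beta>_eq using f(1,3) by (intro LIMSEQ_incseq_SUP) (auto simp: incseq_def le_fun_def)
  have f_le: "f n x \<le> \<beta> x" for n x
    unfolding \<beta>_eq using f(3) by (intro cSUP_upper) auto
  have unhit_sum: "of_bool (unhit \<mu> (f n (W T \<omega>)) r \<omega>) =
      (\<Sum>y\<in>range (f n). of_bool (unhit \<mu> y r \<omega>) * (of_bool (W T \<omega> \<in> f n -` {y}) :: real))" for n \<omega>
    using f_fin by (subst sum_over_values) auto
  have K_sum: "K (f n x) x = (\<Sum>y\<in>range (f n). K y x * of_bool (x \<in> f n -` {y}))" for n x
    using f_fin by (subst sum_over_values) auto
  have K_f_meas[measurable]: "(\<lambda>x. K (f n x) x) \<in> borel_measurable borel" for n
  proof -
    have "(\<lambda>x. K y x * of_bool (x \<in> f n -` {y})) \<in> borel_measurable borel" if "y \<in> range (f n)" for y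
    proof -
      have [measurable]: "K y \<in> borel_measurable borel" using that f(4) by (intro K_meas) auto
      show ?thesis by measurable
    qed
    then show ?thesis unfolding K_sum by (intro borel_measurable_sum)
  qed
  have simple_barrier: "expectation (\<lambda>\<omega>. of_bool (unhit \<mu> (f n (W T \<omega>)) r \<omega>)) =
      (LINT x|lborel. K (f n x) x * ?N x)" for n
  proof -
    have int_M: "integrable M (\<lambda>\<omega>. of_bool (unhit \<mu> y r \<omega>) * (of_bool (W T \<omega> \<in> f n -` {y}) :: real))" for y
    proof -
      have [measurable]: "Measurable.pred M (unhit \<mu> y r)" using r by (rule measurable_unhit)
      show ?thesis by (intro integrable_const_bound[where B=1]) (auto simp: of_bool_def)
    qed
    have int_N: "integrable lborel (\<lambda>x. K y x * of_bool (x \<in> f n -` {y}) * ?N x)" if "y \<in> range (f n)" for y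
    proof -
      have y: "0 \<le> y" using that f(4) by auto
      note K_meas[OF y, measurable]
      have "\<bar>K y x * of_bool (x \<in> f n -` {y})\<bar> \<le> C" for x
        using K_bound[OF y, of x] C by (simp add: of_bool_def)
      then show ?thesis using T by (intro integrable_bounded_times_normal_density[where C=C]) auto
    qed
    have "expectation (\<lambda>\<omega>. of_bool (unhit \<mu> (f n (W T \<omega>)) r \<omega>)) =
        (\<Sum>y\<in>range (f n). expectation (\<lambda>\<omega>. of_bool (unhit \<mu> y r \<omega>) * (of_bool (W T \<omega> \<in> f n -` {y}) :: real)))"
      unfolding unhit_sum using int_M by (intro Bochner_Integration.integral_sum)
    also have "\<dots> = (\<Sum>y\<in>range (f n). (LINT x|lborel. K y x * of_bool (x \<in> f n -` {y}) * ?N x))"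
      using f(4) by (intro sum.cong refl fixed_barrier) auto
    also have "\<dots> = (LINT x|lborel. (\<Sum>y\<in>range (f n). K y x * of_bool (x \<in> f n -` {y}) * ?N x))"
      using int_N by (intro Bochner_Integration.integral_sum[symmetric])
    also have "\<dots> = (LINT x|lborel. K (f n x) x * ?N x)"
      by (simp only: K_sum sum_distrib_right)
    finally show ?thesis .
  qed
  have K_lim: "(\<lambda>n. K (f n x) x) \<longlonglongrightarrow> K (\<beta> x) x" for x
    using continuous_on_tendsto_compose[OF K_cont f_lim, of x x] \<beta>_nonneg f(4) by simp
  have [measurable]: "(\<lambda>x. K (\<beta> x) x) \<in> borel_measurable borel"
    by (rule borel_measurable_LIMSEQ_real[OF K_lim K_f_meas])
  have "(\<lambda>n. expectation (\<lambda>\<omega>. of_bool (unhit \<mu> (f n (W T \<omega>)) r \<omega>) :: real)) \<longlonglongrightarrow>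
      expectation (\<lambda>\<omega>. of_bool (unhit \<mu> (\<beta> (W T \<omega>)) r \<omega>))"
  proof (rule integral_dominated_convergence[where w="\<lambda>_. 1"])
    show "AE \<omega> in M. (\<lambda>n. of_bool (unhit \<mu> (f n (W T \<omega>)) r \<omega>) :: real) \<longlonglongrightarrow> of_bool (unhit \<mu> (\<beta> (W T \<omega>)) r \<omega>)"
      using r f_lim f_le by (intro AE_I2 unhit_tendsto_barrier)
    have "Measurable.pred M (\<lambda>\<omega>. unhit \<mu> (h (W T \<omega>)) r \<omega>)" if "h \<in> borel_measurable borel" for h
      using r that by (intro measurable_unhit_random_barrier) auto
    then show "(\<lambda>\<omega>. of_bool (unhit \<mu> (\<beta> (W T \<omega>)) r \<omega>) :: real) \<in> borel_measurable M"
      "(\<lambda>\<omega>. of_bool (unhit \<mu> (f n (W T \<omega>)) r \<omega>) :: real) \<in> borel_measurable M" for n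
      using \<beta> f_meas by (auto intro!: measurable_compose[OF _ measurable_of_bool])
  qed simp_all
  moreover have "(\<lambda>n. LINT x|lborel. K (f n x) x * ?N x) \<longlonglongrightarrow> (LINT x|lborel. K (\<beta> x) x * ?N x)"
  proof (rule integral_dominated_convergence[where w="\<lambda>x. C * ?N x"])
    show "integrable lborel (\<lambda>x. C * ?N x)" using T by simp
    show "AE x in lborel. (\<lambda>n. K (f n x) x * ?N x) \<longlonglongrightarrow> K (\<beta> x) x * ?N x"
      by (intro AE_I2 tendsto_intros K_lim)
    show "AE x in lborel. norm (K (f n x) x * ?N x) \<le> C * ?N x" for n
      using K_bound[OF f(4)] by (intro AE_I2) (simp add: abs_mult mult_right_mono)
  qed measurable
  ultimately show ?thesis
    unfolding simple_barrier by (rule LIMSEQ_unique)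
qed

lemma prob_hit_random_barrier:
  assumes r: "0 \<le> r" and T: "0 \<le> T" and \<beta>: "\<beta> \<in> borel_measurable borel" and \<beta>_pos: "\<And>x. 0 < \<beta> x"
  shows "prob {\<omega> \<in> space M. Inf (ereal ` {t. 0 < t \<and> \<beta> (W T \<omega>) - \<mu> * t \<le> W t \<omega>}) \<le> ereal r} =
    1 - expectation (\<lambda>\<omega>. of_bool (unhit \<mu> (\<beta> (W T \<omega>)) r \<omega>))"
proof -
  have [measurable]: "Measurable.pred M (\<lambda>\<omega>. unhit \<mu> (\<beta> (W T \<omega>)) r \<omega>)"
    using r \<beta> T by (intro measurable_unhit_random_barrier) auto
  have "Inf (ereal ` {t. 0 < t \<and> \<beta> (W T \<omega>) - \<mu> * t \<le> W t \<omega>}) \<le> ereal r \<longleftrightarrow> \<not> unhit \<mu> (\<beta> (W T \<omega>)) r \<omega>"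
    if \<omega>: "\<omega> \<in> space M" for \<omega>
  proof -
    let ?D = "\<lambda>t. gap \<mu> (\<beta> (W T \<omega>)) t \<omega>"
    have "continuous_on {0..} ?D"
      unfolding gap_def by (intro continuous_intros W_continuous \<omega>)
    moreover have "0 < ?D 0" using \<beta>_pos by (simp add: gap_def W_zero \<omega>)
    ultimately have "Inf (ereal ` {t. 0 < t \<and> ?D t \<le> 0}) \<le> ereal r \<longleftrightarrow> (\<exists>t\<in>{0..r}. ?D t \<le> 0)"
      using r by (rule Inf_hitting_times_le_iff)
    then show ?thesis
      using r \<omega> by (auto simp: unhit_iff gap_def not_less)
  qed
  then have "prob {\<omega> \<in> space M. Inf (ereal ` {t. 0 < t \<and> \<beta> (W T \<omega>) - \<mu> * t \<le> W t \<omega>}) \<le> ereal r} =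
      prob {\<omega> \<in> space M. \<not> unhit \<mu> (\<beta> (W T \<omega>)) r \<omega>}"
    by (intro arg_cong[where f=prob]) auto
  also have "\<dots> = 1 - prob {\<omega> \<in> space M. unhit \<mu> (\<beta> (W T \<omega>)) r \<omega>}"
    by (rule prob_neg) measurable
  also have "prob {\<omega> \<in> space M. unhit \<mu> (\<beta> (W T \<omega>)) r \<omega>} =
      expectation (indicator {\<omega> \<in> space M. unhit \<mu> (\<beta> (W T \<omega>)) r \<omega>})"
    by simp
  also have "\<dots> = expectation (\<lambda>\<omega>. of_bool (unhit \<mu> (\<beta> (W T \<omega>)) r \<omega>))"
    by (intro Bochner_Integration.integral_cong) (auto simp: indicator_def)
  finally show ?thesis .
qed

end

theorem theorem1p2:
  fixes M :: "'a measure" and W :: "real \<Rightarrow> 'a \<Rightarrow> real"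
    and c\<^sub>1 c\<^sub>2 p T r v :: real and g a :: "real \<Rightarrow> real"
    and I :: "'a \<Rightarrow> real" and \<tau> :: "'a \<Rightarrow> ereal"
  assumes "standard_brownian_motion M W"
    and "0 < c\<^sub>1" and "0 < c\<^sub>2" and "1 < p" and "0 < T" and "0 < r"
    and "g \<in> borel_measurable borel" and "\<And>x. 0 < g x"
    and I: "I = (\<lambda>\<omega>. g (W T \<omega>))"
    and \<tau>: "\<tau> = (\<lambda>\<omega>. Inf (ereal ` {t. 0 < t \<and>
            1 / (c\<^sub>2 * (p - 1) * I \<omega> powr (p - 1)) - c\<^sub>1 / c\<^sub>2 * t \<le> W t \<omega>}))"
    and a: "a = (\<lambda>x. 1 / (c\<^sub>2 * (p - 1) * g x powr (p - 1)) - x - c\<^sub>1 * T / c\<^sub>2)"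
    and v: "v = 1 / r - 1 / T"
  shows
    "(r < T \<longrightarrow>
        measure M {\<omega> \<in> space M. \<tau> \<omega> \<le> ereal r} =
          1 - (LINT x|lborel.
                \<Phi> (a x / (T * sqrt v) + sqrt v / (c\<^sub>2 * (p - 1) * g x powr (p - 1)))
                * normal_density 0 (sqrt T) x)
            + (LINT x|lborel.
                exp (- 2 * a x / (T * c\<^sub>2 * (p - 1) * g x powr (p - 1)))
                * \<Phi> (a x / (T * sqrt v) - sqrt v / (c\<^sub>2 * (p - 1) * g x powr (p - 1)))
                * normal_density 0 (sqrt T) x))
     \<and> (r = T \<longrightarrow>
        measure M {\<omega> \<in> space M. \<tau> \<omega> \<le> ereal r} =
          1 - (LINT x|lborel. indicator {x. 0 < a x} x * normal_density 0 (sqrt T) x)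
            + (LINT x|lborel.
                exp (- 2 * a x / (T * c\<^sub>2 * (p - 1) * g x powr (p - 1)))
                * indicator {x. 0 < a x} x * normal_density 0 (sqrt T) x))
     \<and> (T < r \<longrightarrow>
        measure M {\<omega> \<in> space M. \<tau> \<omega> \<le> ereal r} =
          (LINT x|lborel.
                exp (- 2 * a x / (T * c\<^sub>2 * (p - 1) * g x powr (p - 1)))
                * \<Phi> (a x / sqrt (r - T) - c\<^sub>1 * sqrt (r - T) / c\<^sub>2)
                * indicator {x. 0 < a x} x * normal_density 0 (sqrt T) x)
        - (LINT x|lborel.
                exp (- 2 * a x / (T * c\<^sub>2 * (p - 1) * g x powr (p - 1)) + 2 * a x * c\<^sub>1 / c\<^sub>2)
                * \<Phi> (- a x / sqrt (r - T) - c\<^sub>1 * sqrt (r - T) / c\<^sub>2)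
                * indicator {x. 0 < a x} x * normal_density 0 (sqrt T) x)
        + 1
        - (LINT x|lborel.
                \<Phi> (a x / sqrt (r - T) - c\<^sub>1 * sqrt (r - T) / c\<^sub>2)
                * indicator {x. 0 < a x} x * normal_density 0 (sqrt T) x)
        + (LINT x|lborel.
                exp (2 * a x * c\<^sub>1 / c\<^sub>2)
                * \<Phi> (- a x / sqrt (r - T) - c\<^sub>1 * sqrt (r - T) / c\<^sub>2)
                * indicator {x. 0 < a x} x * normal_density 0 (sqrt T) x))"
proof -
  interpret standard_brownian_motion M W by fact
  note c = \<open>0 < c\<^sub>1\<close> \<open>0 < c\<^sub>2\<close> and p = \<open>1 < p\<close> and T = \<open>0 < T\<close> and r = \<open>0 < r\<close>
  note g[measurable] = \<open>g \<in> borel_measurable borel\<close>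
  define \<mu> where "\<mu> = c\<^sub>1 / c\<^sub>2"
  define \<beta> where "\<beta> x = 1 / (c\<^sub>2 * (p - 1) * g x powr (p - 1))" for x
  have \<mu>: "0 \<le> \<mu>" using c by (simp add: \<mu>_def)
  have \<beta>_pos: "0 < \<beta> x" for x using c p \<open>0 < g x\<close> by (simp add: \<beta>_def)
  then have \<beta>_nonneg: "0 \<le> \<beta> x" for x by (simp add: less_imp_le)
  have \<beta>_meas[measurable]: "\<beta> \<in> borel_measurable borel" unfolding \<beta>_def by measurable
  have a_\<beta>: "a x = \<beta> x - x - \<mu> * T" for x by (simp add: a \<beta>_def \<mu>_def)
  have a_meas[measurable]: "a \<in> borel_measurable borel" unfolding a_\<beta>[abs_def] by measurable
  have div_\<beta>: "y / (c\<^sub>2 * (p - 1) * g x powr (p - 1)) = y * \<beta> x" for x y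
    by (simp add: \<beta>_def)
  have exp_\<beta>: "- 2 * a x / (T * c\<^sub>2 * (p - 1) * g x powr (p - 1)) = - 2 * a x * \<beta> x / T" for x
    by (simp add: \<beta>_def mult.assoc mult.commute[of T])
  let ?N = "normal_density 0 (sqrt T)"
  have integrable_N: "integrable lborel (\<lambda>x. f x * ?N x)"
    if "f \<in> borel_measurable borel" "\<And>x. 0 \<le> f x" "\<And>x. f x \<le> 1" for f
    using that T by (intro integrable_bounded_times_normal_density[where C=1]) auto
  have prob_\<tau>: "measure M {\<omega> \<in> space M. \<tau> \<omega> \<le> ereal r} =
      1 - expectation (\<lambda>\<omega>. of_bool (unhit \<mu> (\<beta> (W T \<omega>)) r \<omega>))"
    using prob_hit_random_barrier[OF less_imp_le[OF r] less_imp_le[OF T] \<beta>_meas \<beta>_pos, of \<mu>]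
    unfolding \<tau> I \<beta>_def \<mu>_def .
  show ?thesis
  proof (intro conjI impI)
    assume rT: "r < T"
    let ?P = "\<lambda>x. \<Phi> (a x / (T * sqrt v) + sqrt v * \<beta> x)"
    let ?Q = "\<lambda>x. exp (- 2 * a x * \<beta> x / T) * \<Phi> (a x / (T * sqrt v) - sqrt v * \<beta> x)"
    have K: "survival_given_later \<mu> T r (\<beta> x) x = ?P x - ?Q x" for x
      by (simp only: survival_given_later_def Let_def a_\<beta> v)
    have "expectation (\<lambda>\<omega>. of_bool (unhit \<mu> (\<beta> (W T \<omega>)) r \<omega>)) =
        (LINT x|lborel. survival_given_later \<mu> T r (\<beta> x) x * ?N x)"
      using r T rT \<mu> survival_given_later_bound[OF r rT]
      by (intro expectation_unhit_random_barrier[where C=1] \<beta>_meas \<beta>_nonneg unhit_before_end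
          continuous_on_survival_given_later) auto
    also have "\<dots> = (LINT x|lborel. ?P x * ?N x - ?Q x * ?N x)"
      by (simp only: K left_diff_distrib)
    also have "\<dots> = (LINT x|lborel. ?P x * ?N x) - (LINT x|lborel. ?Q x * ?N x)"
    proof (intro Bochner_Integration.integral_diff integrable_N)
      show "?Q x \<le> 1" for x
        using killed_normal_density_bridge(2)[OF r rT \<beta>_nonneg, of x x \<mu>] by (simp only: a_\<beta> v)
    qed (auto simp: std_normal_cdf_nonneg std_normal_cdf_le_1)
    finally show "measure M {\<omega> \<in> space M. \<tau> \<omega> \<le> ereal r} =
          1 - (LINT x|lborel.
                \<Phi> (a x / (T * sqrt v) + sqrt v / (c\<^sub>2 * (p - 1) * g x powr (p - 1)))
                * normal_density 0 (sqrt T) x)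
            + (LINT x|lborel.
                exp (- 2 * a x / (T * c\<^sub>2 * (p - 1) * g x powr (p - 1)))
                * \<Phi> (a x / (T * sqrt v) - sqrt v / (c\<^sub>2 * (p - 1) * g x powr (p - 1)))
                * normal_density 0 (sqrt T) x)"
      unfolding prob_\<tau> exp_\<beta> div_\<beta> by linarith
  next
    assume rT: "r = T"
    let ?ind = "indicator {x. 0 < a x} :: real \<Rightarrow> real"
    let ?E = "\<lambda>x. exp (- 2 * a x * \<beta> x / T) * ?ind x"
    have K: "survival_given_end \<mu> T (\<beta> x) x = ?ind x - ?E x" for x
    proof -
      have a_alt: "\<beta> x - \<mu> * T - x = a x" by (simp add: a_\<beta>)
      show ?thesis
        unfolding survival_given_end_def a_alt by (cases "0 < a x") (simp_all add: mult_ac)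
    qed
    have "expectation (\<lambda>\<omega>. of_bool (unhit \<mu> (\<beta> (W T \<omega>)) r \<omega>)) =
        (LINT x|lborel. survival_given_end \<mu> T (\<beta> x) x * ?N x)"
      unfolding rT using T \<mu> survival_given_end_bounds[OF T]
      by (intro expectation_unhit_random_barrier[where C=1] \<beta>_meas \<beta>_nonneg unhit_at_end
          continuous_on_survival_given_end) auto
    also have "\<dots> = (LINT x|lborel. ?ind x * ?N x - ?E x * ?N x)"
      by (simp only: K left_diff_distrib)
    also have "\<dots> = (LINT x|lborel. ?ind x * ?N x) - (LINT x|lborel. ?E x * ?N x)"
    proof (intro Bochner_Integration.integral_diff integrable_N)
      show "?E x \<le> 1" for x
        using \<beta>_nonneg[of x] T by (simp add: indicator_def mult_nonneg_nonneg)
    qed (auto simp: indicator_def)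
    finally show "measure M {\<omega> \<in> space M. \<tau> \<omega> \<le> ereal r} =
          1 - (LINT x|lborel. indicator {x. 0 < a x} x * normal_density 0 (sqrt T) x)
            + (LINT x|lborel.
                exp (- 2 * a x / (T * c\<^sub>2 * (p - 1) * g x powr (p - 1)))
                * indicator {x. 0 < a x} x * normal_density 0 (sqrt T) x)"
      unfolding prob_\<tau> exp_\<beta> by linarith
  next
    assume Tr: "T < r"
    then have s: "0 < r - T" by simp
    let ?ind = "indicator {x. 0 < a x} :: real \<Rightarrow> real"
    let ?e = "\<lambda>x. exp (- 2 * a x * \<beta> x / T)"
    let ?P = "\<lambda>x. \<Phi> (a x / sqrt (r - T) - c\<^sub>1 * sqrt (r - T) / c\<^sub>2)"
    let ?Q = "\<lambda>x. \<Phi> (- a x / sqrt (r - T) - c\<^sub>1 * sqrt (r - T) / c\<^sub>2)"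
    let ?e2 = "\<lambda>x. exp (2 * a x * c\<^sub>1 / c\<^sub>2)"
    define K where "K b x = survival_given_end \<mu> T b x * survival \<mu> (r - T) (b - \<mu> * T - x)" for b x
    have survival_a: "survival \<mu> (r - T) (a x) = ?P x - ?e2 x * ?Q x" for x
      by (simp add: survival_def \<mu>_def)
    have K_\<beta>: "K (\<beta> x) x = ?P x * ?ind x - ?e2 x * ?Q x * ?ind x -
        (?e x * ?P x * ?ind x - ?e x * ?e2 x * ?Q x * ?ind x)" for x
    proof -
      have a_alt: "\<beta> x - \<mu> * T - x = a x" by (simp add: a_\<beta>)
      have expand: "(1 - e) * i * (P - f * Q) = P * i - f * Q * i - (e * P * i - e * f * Q * i)"
        for e f i P Q :: real by (simp add: algebra_simps)
      have end_\<beta>: "survival_given_end \<mu> T (\<beta> x) x = (1 - ?e x) * ?ind x"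
        unfolding survival_given_end_def a_alt by (cases "0 < a x") (simp_all add: mult_ac)
      show ?thesis
        unfolding K_def a_alt survival_a end_\<beta> by (rule expand)
    qed
    have "expectation (\<lambda>\<omega>. of_bool (unhit \<mu> (\<beta> (W T \<omega>)) r \<omega>)) = (LINT x|lborel. K (\<beta> x) x * ?N x)"
    proof (rule expectation_unhit_random_barrier[where C=1])
      show "K b \<in> borel_measurable borel" for b unfolding K_def by measurable
      show "continuous_on {0..} (\<lambda>b. K b x)" for x
        unfolding K_def using s T
        by (intro continuous_intros continuous_on_survival_given_end continuous_on_survival) auto
      show "\<bar>K b x\<bar> \<le> 1" if b: "0 \<le> b" for b x
      proof (cases "0 \<le> b - \<mu> * T - x")
        case True
        then show ?thesis
          using survival_bound[OF s True, of \<mu>] survival_given_end_bounds[OF T b, of \<mu> x]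
          by (simp add: K_def abs_mult mult_le_one)
      qed (simp add: K_def survival_given_end_def)
      show "expectation (\<lambda>\<omega>. of_bool (unhit \<mu> b r \<omega>) * of_bool (W T \<omega> \<in> A)) =
          (LINT x|lborel. K b x * of_bool (x \<in> A) * ?N x)" if "0 \<le> b" "A \<in> sets borel" for b A
        unfolding K_def using that by (intro unhit_after_end \<mu> T Tr)
    qed (use r T \<beta>_nonneg in auto)
    also have "\<dots> = (LINT x|lborel. (?P x * ?ind x * ?N x - ?e2 x * ?Q x * ?ind x * ?N x) -
        (?e x * ?P x * ?ind x * ?N x - ?e x * ?e2 x * ?Q x * ?ind x * ?N x))"
      by (simp only: K_\<beta> left_diff_distrib)
    also have "\<dots> = ((LINT x|lborel. ?P x * ?ind x * ?N x) - (LINT x|lborel. ?e2 x * ?Q x * ?ind x * ?N x)) -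
        ((LINT x|lborel. ?e x * ?P x * ?ind x * ?N x) - (LINT x|lborel. ?e x * ?e2 x * ?Q x * ?ind x * ?N x))"
    proof -
      have e_le: "?e x \<le> 1" if "0 < a x" for x
        using that \<beta>_nonneg[of x] T by (simp add: mult_nonneg_nonneg)
      have e2Q: "?e2 x * ?Q x \<le> 1" if "0 < a x" for x
        using killed_normal_density_survival(2)[OF s less_imp_le[OF that], of \<mu>] by (simp add: \<mu>_def)
      have ee2Q: "?e x * ?e2 x * ?Q x \<le> 1" if "0 < a x" for x
        using mult_le_one[OF e_le[OF that] _ e2Q[OF that]] std_normal_cdf_nonneg by (simp add: mult.assoc)
      have 1: "integrable lborel (\<lambda>x. ?P x * ?ind x * ?N x)"
        by (rule integrable_N) (auto simp: indicator_def std_normal_cdf_nonneg std_normal_cdf_le_1)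
      have 2: "integrable lborel (\<lambda>x. ?e2 x * ?Q x * ?ind x * ?N x)"
        by (rule integrable_N) (use e2Q in \<open>auto simp: indicator_def std_normal_cdf_nonneg\<close>)
      have 3: "integrable lborel (\<lambda>x. ?e x * ?P x * ?ind x * ?N x)"
        by (rule integrable_N)
          (use e_le in \<open>auto simp: indicator_def std_normal_cdf_nonneg std_normal_cdf_le_1 intro!: mult_le_one\<close>)
      have 4: "integrable lborel (\<lambda>x. ?e x * ?e2 x * ?Q x * ?ind x * ?N x)"
        by (rule integrable_N)
          (use ee2Q in \<open>auto simp: indicator_def std_normal_cdf_nonneg\<close>)
      show ?thesis
        by (simp only: Bochner_Integration.integral_diff[OF Bochner_Integration.integrable_diff[OF 1 2]
              Bochner_Integration.integrable_diff[OF 3 4]]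
            Bochner_Integration.integral_diff[OF 1 2] Bochner_Integration.integral_diff[OF 3 4])
    qed
    finally show "measure M {\<omega> \<in> space M. \<tau> \<omega> \<le> ereal r} =
          (LINT x|lborel.
                exp (- 2 * a x / (T * c\<^sub>2 * (p - 1) * g x powr (p - 1)))
                * \<Phi> (a x / sqrt (r - T) - c\<^sub>1 * sqrt (r - T) / c\<^sub>2)
                * indicator {x. 0 < a x} x * normal_density 0 (sqrt T) x)
        - (LINT x|lborel.
                exp (- 2 * a x / (T * c\<^sub>2 * (p - 1) * g x powr (p - 1)) + 2 * a x * c\<^sub>1 / c\<^sub>2)
                * \<Phi> (- a x / sqrt (r - T) - c\<^sub>1 * sqrt (r - T) / c\<^sub>2)
                * indicator {x. 0 < a x} x * normal_density 0 (sqrt T) x)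
        + 1
        - (LINT x|lborel.
                \<Phi> (a x / sqrt (r - T) - c\<^sub>1 * sqrt (r - T) / c\<^sub>2)
                * indicator {x. 0 < a x} x * normal_density 0 (sqrt T) x)
        + (LINT x|lborel.
                exp (2 * a x * c\<^sub>1 / c\<^sub>2)
                * \<Phi> (- a x / sqrt (r - T) - c\<^sub>1 * sqrt (r - T) / c\<^sub>2)
                * indicator {x. 0 < a x} x * normal_density 0 (sqrt T) x)"
      unfolding prob_\<tau> exp_\<beta> exp_add by linarith
  qed
qed

end
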